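(* Let $\rho$ be an admissible sequence, let $0<p\le\infty$, and let $n\ge 1$. Then: (i) the set $\Lambda_{n,\rho}$ minimizes $E^*_\Lambda(\mathcal{U}_{\rho,p})$ over all lower sets $\Lambda\in\mathcal{L}_n$, and $$E_n(\mathcal{U}_{\rho,p})\le E_{\Lambda_{n,\rho}}(\mathcal{U}_{\rho,p})\le E^*_{\Lambda_{n,\rho}}(\mathcal{U}_{\rho,p});$$ (ii) if $p\ge 1$ and $q$ is the conjugate index to $p$, i.e. $1/p+1/q=1$, then $$E_n(\mathcal{U}_{\rho,p})\le E_{\Lambda_{n,\rho}}(\mathcal{U}_{\rho,p})\le E^*_{\Lambda_{n,\rho}}(\mathcal{U}_{\rho,p})=\delta_{n,q}(\rho).$$
   Context: A sequence $\rho=(\rho_1,\rho_2,\dots)$ of positive real numbers is called admissible if it is nondecreasing, $\rho_1>1$ and $\lim_{j\to\infty}\rho_j=\infty$. $X$ is a nonzero Banach space, $\mathbb{N}=\{1,2,\dots\}$, $\mathbb{N}_0=\mathbb{N}\cup\{0\}$, $Y=[-1,1]^{\mathbb{N}}$. $\mathcal{F}$ is the set of all sequences $\nu=(\nu_1,\nu_2,\dots)$ with entries in $\mathbb{N}_0$ and only finitely many nonzero entries. Multi-index notation: $y^\nu=\prod_j y_j^{\nu_j}$, $\rho^\nu=\prod_j\rho_j^{\nu_j}$, $\rho^{-\nu}=1/\rho^\nu$. $L_\infty(Y,X)$ is the space of bounded maps $v:Y\to X$ with $\|v\|_{L_\infty(Y,X)}=\sup_{y\in Y}\|v(y)\|_X$.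 For $0<p\le\infty$, $\mathcal{B}_{\rho,p}$ is the set of $u\in L_\infty(Y,X)$ which admit a representation $u(y)=\sum_{\nu\in\mathcal{F}}t_\nu y^\nu$, $y\in Y$, with unique coefficients $t_\nu=t_\nu(u)\in X$, where the series converges uniformly unconditionally on $Y$ (any rearrangement converges in $X$ to $u$, uniformly on $Y$), and with $\|u\|_{\mathcal{B}_{\rho,p}}:=\|(\rho^\nu\|t_\nu\|_X)_{\nu\in\mathcal{F}}\|_{\ell_p(\mathcal{F})}<\infty$. $\mathcal{U}_{\rho,p}=\{u:\|u\|_{\mathcal{B}_{\rho,p}}\le 1\}$ is its unit ball. A set $\Lambda\subset\mathcal{F}$ is a lower set if $\nu\in\Lambda$ and $\mu\in\mathcal{F}$ with $\mu_j\le\nu_j$ for all $j$ imply $\mu\in\Lambda$. For $n\ge1$, $\mathcal{L}_n$ is the collection of lower sets $\Lambda\subset\mathcal{F}$ with $\#\Lambda\le n$. For finite $\Lambda\subset\mathcal{F}$, $\mathcal{P}_\Lambda=\{\sum_{\nu\in\Lambda}c_\nu y^\nu: c_\nu\in X\}$. Errors: $E_\Lambda(u)=\inf_{P\in\mathcal{P}_\Lambda}\|u-P\|_{L_\infty(Y,X)}$, $E_\Lambda(K)=\sup_{u\in K}E_\Lambda(u)$, $E_n(K)=\inf_{\Lambda\in\mathcal{L}_n}E_\Lambda(K)$. Surrogate norm and errors: for $u\in L_\infty(Y,X)$ admitting a representation $u(y)=\sum_{\nu\in\mathcal{F}}t_\nu y^\nu$, $y\in Y$, with unique coefficients $t_\nu\in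 X$ and with the series converging uniformly unconditionally on $Y$, $\|u\|^*=\sum_{\nu\in\mathcal{F}}\|t_\nu\|_X$ (value $+\infty$ allowed), $E^*_\Lambda(u)=\inf_{P\in\mathcal{P}_\Lambda}\|u-P\|^*=\sum_{\nu\notin\Lambda}\|t_\nu\|_X$, and $E^*_\Lambda(K)=\sup_{u\in K}E^*_\Lambda(u)$. For $\varepsilon>0$, $\Lambda(\varepsilon,\rho)=\{\nu\in\mathcal{F}:\rho^{-\nu}\ge\varepsilon\}$ (a finite lower set). $(\delta_n)_{n\ge1}=(\delta_n(\rho))_{n\ge1}$ is the decreasing rearrangement of $(\rho^{-\nu})_{\nu\in\mathcal{F}}$ (with repetitions). $\Lambda_{n,\rho}$ denotes any lower set of cardinality $n$ contained in $\Lambda(\delta_n(\rho),\rho)$ and containing all $\nu$ with $\rho^{-\nu}>\delta_n(\rho)$ (such a set exists, possibly not unique). Finally $\delta_{n,q}(\rho)=\big(\sum_{\nu\notin\Lambda_{n,\rho}}\rho^{-\nu q}\big)^{1/q}=\big(\sum_{j>n}\delta_j^q\big)^{1/q}\in[0,\infty]$ for $0<q<\infty$, and $\delta_{n,\infty}(\rho)=\delta_{n+1}(\rho)$. *)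

theory Defs
  imports "HOL-Analysis.Analysis" "HOL-Library.Poly_Mapping"
begin

text \<open>
  The coordinates, indexed by 1, 2, ... in the mathematical text, are indexed here by the type
  \<^typ>\<open>nat\<close>, so \<open>\<rho> 0\<close> and \<open>y 0\<close> are the first entries.  Numbers that are
  allowed to be infinite (the exponents, norms and errors) are of type \<^typ>\<open>ennreal\<close>.
\<close>

definition admissible :: "(nat \<Rightarrow> real) \<Rightarrow> bool" where
  "admissible \<rho> \<longleftrightarrow>
     (\<forall>j. \<rho> j > 0) \<and> mono \<rho> \<and> \<rho> 0 > 1 \<and> filterlim \<rho> at_top sequentially"

text \<open>
  The type of finitely supported sequences is the whole set of multi-indices.  Its library order
  is lexicographic and is never used here; the componentwise order is written out.
\<close>

type_synonym multiindex = "nat \<Rightarrow>\<^sub>0 nat"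

definition mpow :: "(nat \<Rightarrow> real) \<Rightarrow> multiindex \<Rightarrow> real" where
  "mpow y \<nu> = (\<Prod>j\<in>Poly_Mapping.keys \<nu>. y j ^ Poly_Mapping.lookup \<nu> j)"

definition cube :: "(nat \<Rightarrow> real) set" where
  "cube = {y. \<forall>j. - 1 \<le> y j \<and> y j \<le> 1}"

text \<open>
  Maps on the cube are represented by functions on all real sequences; every notion below depends
  only on their values on the cube.
\<close>

definition linf_norm :: "((nat \<Rightarrow> real) \<Rightarrow> 'x::real_normed_vector) \<Rightarrow> ennreal" where
  "linf_norm v = (SUP y\<in>cube. ennreal (norm (v y)))"

definition linf_space :: "((nat \<Rightarrow> real) \<Rightarrow> 'x::real_normed_vector) set" where
  "linf_space = {v. bounded (v ` cube)}"

text \<open>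
  Uniform unconditional convergence: along every enumeration of the multi-indices the partial
  sums converge to \<open>u\<close> uniformly on the cube.
\<close>

definition has_expansion ::
  "(multiindex \<Rightarrow> 'x::real_normed_vector) \<Rightarrow> ((nat \<Rightarrow> real) \<Rightarrow> 'x) \<Rightarrow> bool" where
  "has_expansion t u \<longleftrightarrow>
     (\<forall>e :: nat \<Rightarrow> multiindex. bij e \<longrightarrow>
        uniform_limit cube (\<lambda>N y. \<Sum>k<N. mpow y (e k) *\<^sub>R t (e k)) u sequentially)"

definition representable :: "((nat \<Rightarrow> real) \<Rightarrow> 'x::real_normed_vector) \<Rightarrow> bool" where
  "representable u \<longleftrightarrow> (\<exists>!t. has_expansion t u)"

text \<open>The coefficients are meaningful only for representable \<open>u\<close>.\<close>

definition coeffs :: "((nat \<Rightarrow> real) \<Rightarrow> 'x::real_normed_vector) \<Rightarrow> multiindex \<Rightarrow> 'x" where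
  "coeffs u = (THE t. has_expansion t u)"

definition ennreal_powr :: "ennreal \<Rightarrow> real \<Rightarrow> ennreal" where
  "ennreal_powr s r = (if s = \<infinity> then \<infinity> else ennreal (enn2real s powr r))"

text \<open>The quasi-norm of \<open>\<ell>\<^sub>p(I)\<close> for \<open>0 < p \<le> \<infinity>\<close>, with value infinity off the space.\<close>

definition lp_norm :: "ennreal \<Rightarrow> ('i \<Rightarrow> real) \<Rightarrow> 'i set \<Rightarrow> ennreal" where
  "lp_norm p a I =
     (if p = \<infinity> then (SUP i\<in>I. ennreal \<bar>a i\<bar>)
      else ennreal_powr (\<Sum>\<^sub>\<infinity>i\<in>I. ennreal (\<bar>a i\<bar> powr enn2real p)) (1 / enn2real p))"

definition B_norm ::
  "(nat \<Rightarrow> real) \<Rightarrow> ennreal \<Rightarrow> ((nat \<Rightarrow> real) \<Rightarrow> 'x::real_normed_vector) \<Rightarrow> ennreal" where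
  "B_norm \<rho> p u = lp_norm p (\<lambda>\<nu>. mpow \<rho> \<nu> * norm (coeffs u \<nu>)) UNIV"

definition B_space ::
  "(nat \<Rightarrow> real) \<Rightarrow> ennreal \<Rightarrow> ((nat \<Rightarrow> real) \<Rightarrow> 'x::real_normed_vector) set" where
  "B_space \<rho> p = {u \<in> linf_space. representable u \<and> B_norm \<rho> p u < \<infinity>}"

definition B_ball ::
  "(nat \<Rightarrow> real) \<Rightarrow> ennreal \<Rightarrow> ((nat \<Rightarrow> real) \<Rightarrow> 'x::real_normed_vector) set" where
  "B_ball \<rho> p = {u \<in> B_space \<rho> p. B_norm \<rho> p u \<le> 1}"

definition lower_set :: "multiindex set \<Rightarrow> bool" where
  "lower_set \<Lambda> \<longleftrightarrow>
     (\<forall>\<nu>\<in>\<Lambda>. \<forall>\<mu>. (\<forall>j. Poly_Mapping.lookup \<mu> j \<le> Poly_Mapping.lookup \<nu> j) \<longrightarrow> \<mu> \<in> \<Lambda>)"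

definition lower_sets :: "nat \<Rightarrow> multiindex set set" where
  "lower_sets n = {\<Lambda>. lower_set \<Lambda> \<and> finite \<Lambda> \<and> card \<Lambda> \<le> n}"

definition polys :: "multiindex set \<Rightarrow> ((nat \<Rightarrow> real) \<Rightarrow> 'x::real_normed_vector) set" where
  "polys \<Lambda> = {P. \<exists>c. P = (\<lambda>y. \<Sum>\<nu>\<in>\<Lambda>. mpow y \<nu> *\<^sub>R c \<nu>)}"

definition err_fun ::
  "multiindex set \<Rightarrow> ((nat \<Rightarrow> real) \<Rightarrow> 'x::real_normed_vector) \<Rightarrow> ennreal" where
  "err_fun \<Lambda> u = (INF P\<in>polys \<Lambda>. linf_norm (\<lambda>y. u y - P y))"

definition err_set ::
  "multiindex set \<Rightarrow> ((nat \<Rightarrow> real) \<Rightarrow> 'x::real_normed_vector) set \<Rightarrow> ennreal" where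
  "err_set \<Lambda> K = (SUP u\<in>K. err_fun \<Lambda> u)"

definition err_n :: "nat \<Rightarrow> ((nat \<Rightarrow> real) \<Rightarrow> 'x::real_normed_vector) set \<Rightarrow> ennreal" where
  "err_n n K = (INF \<Lambda>\<in>lower_sets n. err_set \<Lambda> K)"

definition star_norm :: "((nat \<Rightarrow> real) \<Rightarrow> 'x::real_normed_vector) \<Rightarrow> ennreal" where
  "star_norm u = (\<Sum>\<^sub>\<infinity>\<nu>. ennreal (norm (coeffs u \<nu>)))"

definition star_err_fun ::
  "multiindex set \<Rightarrow> ((nat \<Rightarrow> real) \<Rightarrow> 'x::real_normed_vector) \<Rightarrow> ennreal" where
  "star_err_fun \<Lambda> u = (INF P\<in>polys \<Lambda>. star_norm (\<lambda>y. u y - P y))"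

definition star_err_set ::
  "multiindex set \<Rightarrow> ((nat \<Rightarrow> real) \<Rightarrow> 'x::real_normed_vector) set \<Rightarrow> ennreal" where
  "star_err_set \<Lambda> K = (SUP u\<in>K. star_err_fun \<Lambda> u)"

definition superlevel :: "real \<Rightarrow> (nat \<Rightarrow> real) \<Rightarrow> multiindex set" where
  "superlevel \<epsilon> \<rho> = {\<nu>. inverse (mpow \<rho> \<nu>) \<ge> \<epsilon>}"

definition decreasing_rearrangement :: "('i \<Rightarrow> real) \<Rightarrow> (nat \<Rightarrow> real) \<Rightarrow> bool" where
  "decreasing_rearrangement a d \<longleftrightarrow> decseq d \<and> (\<exists>e. bij e \<and> d = a \<circ> e)"

text \<open>
  The rearrangement is enumerated from 0, whereas \<open>delta \<rho> n\<close> is meant for \<open>n \<ge> 1\<close>, with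
  \<open>delta \<rho> 1\<close> the largest value.  Existence and uniqueness for admissible \<open>\<rho>\<close> are shown below.
\<close>

definition delta :: "(nat \<Rightarrow> real) \<Rightarrow> nat \<Rightarrow> real" where
  "delta \<rho> n = (THE d. decreasing_rearrangement (\<lambda>\<nu>. inverse (mpow \<rho> \<nu>)) d) (n - 1)"

text \<open>
  The set \<open>\<Lambda>\<^bsub>n,\<rho>\<^esub>\<close> need not be unique, so it is specified by a predicate; that such a set exists
  is shown at the end of this theory.
\<close>

definition is_Lambda :: "nat \<Rightarrow> (nat \<Rightarrow> real) \<Rightarrow> multiindex set \<Rightarrow> bool" where
  "is_Lambda n \<rho> \<Lambda> \<longleftrightarrow>
     lower_set \<Lambda> \<and> finite \<Lambda> \<and> card \<Lambda> = n \<and> \<Lambda> \<subseteq> superlevel (delta \<rho> n) \<rho> \<and>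
     {\<nu>. inverse (mpow \<rho> \<nu>) > delta \<rho> n} \<subseteq> \<Lambda>"

definition delta_tail :: "nat \<Rightarrow> ennreal \<Rightarrow> (nat \<Rightarrow> real) \<Rightarrow> ennreal" where
  "delta_tail n q \<rho> =
     (if q = \<infinity> then ennreal (delta \<rho> (n + 1)) else lp_norm q (delta \<rho>) {n<..})"


subsection \<open>The rearrangement and the sets \<open>\<Lambda>\<^bsub>n,\<rho>\<^esub>\<close> are well defined\<close>

lemma admissible_gt_1: "admissible \<rho> \<Longrightarrow> \<rho> j > 1"
  by (metis admissible_def less_le_trans monoD zero_le)

lemma mpow_superset:
  assumes "finite A" "Poly_Mapping.keys \<nu> \<subseteq> A"
  shows "mpow y \<nu> = (\<Prod>j\<in>A. y j ^ Poly_Mapping.lookup \<nu> j)"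
  unfolding mpow_def using assms
  by (intro prod.mono_neutral_left) (auto simp: in_keys_iff)

lemma mpow_pos: "admissible \<rho> \<Longrightarrow> mpow \<rho> \<nu> > 0"
  unfolding mpow_def by (intro prod_pos) (simp add: admissible_def)

lemma factor_le_mpow:
  assumes "admissible \<rho>" shows "\<rho> j ^ Poly_Mapping.lookup \<nu> j \<le> mpow \<rho> \<nu>"
proof -
  have ge1: "1 \<le> \<rho> i ^ k" for i k
    using admissible_gt_1[OF assms, of i] by (intro one_le_power) simp
  have "mpow \<rho> \<nu> = (\<Prod>i\<in>insert j (Poly_Mapping.keys \<nu>). \<rho> i ^ Poly_Mapping.lookup \<nu> i)"
    by (rule mpow_superset) auto
  also have "\<dots> = \<rho> j ^ Poly_Mapping.lookup \<nu> j *
      (\<Prod>i\<in>Poly_Mapping.keys \<nu> - {j}. \<rho> i ^ Poly_Mapping.lookup \<nu> i)"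
    by (simp add: prod.insert_remove)
  also have "\<dots> \<ge> \<rho> j ^ Poly_Mapping.lookup \<nu> j * 1"
    using ge1 admissible_gt_1[OF assms, of j] by (intro mult_left_mono prod_ge_1) auto
  finally show ?thesis by simp
qed

lemma finite_superlevel:
  assumes "admissible \<rho>" "\<epsilon> > 0" shows "finite (superlevel \<epsilon> \<rho>)"
proof -
  obtain J where J: "\<And>j. j \<ge> J \<Longrightarrow> \<rho> j > 1 / \<epsilon>"
    using assms(1) unfolding admissible_def filterlim_at_top_dense eventually_sequentially by blast
  obtain M where M: "1 / \<epsilon> < \<rho> 0 ^ M"
    using real_arch_pow[OF admissible_gt_1[OF assms(1)]] by blast
  have le: "\<rho> j ^ Poly_Mapping.lookup \<nu> j \<le> 1 / \<epsilon>" if "\<nu> \<in> superlevel \<epsilon> \<rho>" for \<nu> j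
  proof -
    have "mpow \<rho> \<nu> \<le> 1 / \<epsilon>"
      using that assms(2) mpow_pos[OF assms(1), of \<nu>] by (simp add: superlevel_def field_simps)
    then show ?thesis using factor_le_mpow[OF assms(1), of j \<nu>] by simp
  qed
  have zero: "Poly_Mapping.lookup \<nu> j = 0" if "\<nu> \<in> superlevel \<epsilon> \<rho>" "j \<ge> J" for \<nu> j
  proof (rule ccontr)
    assume "Poly_Mapping.lookup \<nu> j \<noteq> 0"
    then have "\<rho> j \<le> \<rho> j ^ Poly_Mapping.lookup \<nu> j"
      using admissible_gt_1[OF assms(1), of j] by (intro self_le_power) auto
    then show False using le[OF that(1), of j] J[OF that(2)] by simp
  qed
  have bound: "Poly_Mapping.lookup \<nu> j \<le> M" if "\<nu> \<in> superlevel \<epsilon> \<rho>" for \<nu> j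
  proof (rule ccontr)
    assume "\<not> Poly_Mapping.lookup \<nu> j \<le> M"
    then have "\<rho> 0 ^ M \<le> \<rho> 0 ^ Poly_Mapping.lookup \<nu> j"
      using admissible_gt_1[OF assms(1), of 0] by (intro power_increasing) auto
    also have "\<dots> \<le> \<rho> j ^ Poly_Mapping.lookup \<nu> j"
      using assms(1) by (intro power_mono) (auto simp: admissible_def mono_def less_imp_le)
    finally show False using le[OF that, of j] M by simp
  qed
  have "finite (Poly_Mapping.lookup ` superlevel \<epsilon> \<rho>)"
  proof (rule finite_subset)
    show "Poly_Mapping.lookup ` superlevel \<epsilon> \<rho> \<subseteq>
        {f. \<forall>j. (j \<in> {..<J} \<longrightarrow> f j \<in> {..M}) \<and> (j \<notin> {..<J} \<longrightarrow> f j = 0)}"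
      using zero bound by auto
  qed (intro finite_set_of_finite_funs; simp)
  then show ?thesis
    by (rule finite_imageD) (meson inj_onI lookup_inject)
qed

lemma infinite_multiindex: "infinite (UNIV :: multiindex set)"
proof -
  have "inj (\<lambda>k::nat. Poly_Mapping.single (0::nat) k)"
    by (metis injI lookup_single_eq)
  then show ?thesis by (meson finite_imageD finite_subset infinite_UNIV_nat subset_UNIV)
qed

lemma ex_decreasing_rearrangement:
  fixes a :: "'i \<Rightarrow> real"
  assumes inf: "infinite (UNIV :: 'i set)" and pos: "\<And>i. a i > 0"
    and fin: "\<And>\<epsilon>. \<epsilon> > 0 \<Longrightarrow> finite {i. a i \<ge> \<epsilon>}"
  shows "\<exists>d. decreasing_rearrangement a d"
proof -
  have "(UNIV :: 'i set) = (\<Union>k. {i. a i \<ge> inverse (real (Suc k))})"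
    using pos by (auto simp del: of_nat_Suc) (meson reals_Archimedean less_imp_le)
  moreover have "countable (\<Union>k. {i. a i \<ge> inverse (real (Suc k))})"
    by (rule countable_UN) (auto intro!: countable_finite fin)
  ultimately have "countable (UNIV :: 'i set)" by simp
  then obtain f :: "'i \<Rightarrow> nat" where f: "inj f" by (auto simp: countable_def)
  define before where "before i = {j. a j > a i \<or> a j = a i \<and> f j < f i}" for i
  have finb: "finite (before i)" for i
    by (rule finite_subset[OF _ fin[OF pos[of i]]]) (auto simp: before_def)
  define rank where "rank i = card (before i)" for i
  have less: "rank i < rank j" if "i \<in> before j" for i j
    unfolding rank_def using that
    by (intro psubset_card_mono finb) (auto simp: before_def)
  have total: "i \<in> before j \<or> j \<in> before i" if "i \<noteq> j" for i j
  proof -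
    have "f i \<noteq> f j" using that f by (simp add: inj_eq)
    then show ?thesis unfolding before_def by (simp, linarith)
  qed
  have inj: "inj rank"
    by (rule injI) (metis less less_irrefl total)
  have down: "rank ` before i = {..<rank i}" for i
  proof (rule card_subset_eq)
    show "card (rank ` before i) = card {..<rank i}"
      using card_image[OF inj_on_subset[OF inj subset_UNIV]] by (simp add: rank_def)
  qed (auto intro: less)
  have "\<exists>i. rank i = m" for m
  proof -
    have "infinite (range rank)" using inf inj finite_imageD by blast
    then obtain i where "rank i > m" by (metis finite_nat_set_iff_bounded_le not_le rangeE)
    then have "m \<in> rank ` before i" using down by auto
    then show ?thesis by auto
  qed
  then have surj: "surj rank" unfolding surj_def by metis
  have "bij (inv rank)" by (intro bij_imp_bij_inv bijI inj surj)
  moreover have "decseq (a \<circ> inv rank)"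
  proof (rule decseq_SucI)
    fix k
    have "rank (inv rank k) = k" "rank (inv rank (Suc k)) = Suc k"
      using surj by (simp_all add: surj_f_inv_f)
    then have "inv rank (Suc k) \<notin> before (inv rank k)" using less by fastforce
    then show "(a \<circ> inv rank) (Suc k) \<le> (a \<circ> inv rank) k" by (auto simp: before_def)
  qed
  ultimately show ?thesis unfolding decreasing_rearrangement_def by blast
qed

lemma decreasing_rearrangement_unique:
  fixes a :: "'i \<Rightarrow> real"
  assumes "decreasing_rearrangement a d" "decreasing_rearrangement a d'"
    and pos: "\<And>i. a i > 0" and fin: "\<And>\<epsilon>. \<epsilon> > 0 \<Longrightarrow> finite {i. a i \<ge> \<epsilon>}"
  shows "d = d'"
proof -
  have le: "d n \<le> d' n"
    if d: "decreasing_rearrangement a d" and d': "decreasing_rearrangement a d'" for d d' n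
  proof (rule ccontr)
    assume "\<not> d n \<le> d' n"
    then have lt: "d' n < d n" by simp
    obtain e e' where e: "bij e" "d = a \<circ> e" "decseq d" and e': "bij e'" "d' = a \<circ> e'" "decseq d'"
      using d d' unfolding decreasing_rearrangement_def by blast
    have "e ` {..n} \<subseteq> {i. a i \<ge> d n}" using e by (auto simp: decseq_def)
    moreover have "{i. a i \<ge> d n} \<subseteq> e' ` {..<n}"
    proof
      fix i assume i: "i \<in> {i. a i \<ge> d n}"
      obtain k where k: "i = e' k" using e'(1) by (meson bij_pointE)
      have "k < n"
      proof (rule ccontr)
        assume "\<not> k < n"
        then have "d' k \<le> d' n" using e'(3) by (simp add: decseq_def)
        then show False using i k e'(2) lt by simp
      qed
      then show "i \<in> e' ` {..<n}" using k by simp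
    qed
    ultimately have "card (e ` {..n}) \<le> card (e' ` {..<n})"
      by (intro card_mono) auto
    moreover have "card (e ` {..n}) = Suc n"
      using e(1) by (subst card_image) (auto simp: bij_def inj_on_def)
    ultimately show False using card_image_le[of "{..<n}" e'] by simp
  qed
  show ?thesis using le[OF assms(1,2)] le[OF assms(2,1)] by (intro ext antisym)
qed

lemma ex1_delta_sequence:
  assumes "admissible \<rho>"
  shows "\<exists>!d. decreasing_rearrangement (\<lambda>\<nu>. inverse (mpow \<rho> \<nu>)) d"
proof -
  have pos: "inverse (mpow \<rho> \<nu>) > 0" for \<nu> using mpow_pos[OF assms] by simp
  have fin: "finite {\<nu>. inverse (mpow \<rho> \<nu>) \<ge> \<epsilon>}" if "\<epsilon> > 0" for \<epsilon>
    using finite_superlevel[OF assms that] by (simp add: superlevel_def)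
  show ?thesis
    using ex_decreasing_rearrangement[of "\<lambda>\<nu>. inverse (mpow \<rho> \<nu>)", OF infinite_multiindex pos fin]
      decreasing_rearrangement_unique[of "\<lambda>\<nu>. inverse (mpow \<rho> \<nu>)", OF _ _ pos fin] by blast
qed

lemma mpow_strict_mono:
  assumes "admissible \<rho>" "\<And>j. Poly_Mapping.lookup \<mu> j \<le> Poly_Mapping.lookup \<nu> j" "\<mu> \<noteq> \<nu>"
  shows "mpow \<rho> \<mu> < mpow \<rho> \<nu>"
proof -
  let ?A = "Poly_Mapping.keys \<nu>"
  have sub: "Poly_Mapping.keys \<mu> \<subseteq> ?A"
    using assms(2) by (metis in_keys_iff le_zero_eq subsetI)
  obtain i where i: "Poly_Mapping.lookup \<mu> i < Poly_Mapping.lookup \<nu> i"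
    using assms(2,3) by (metis le_neq_implies_less poly_mapping_eqI)
  have "(\<Prod>j\<in>?A. \<rho> j ^ Poly_Mapping.lookup \<mu> j) < (\<Prod>j\<in>?A. \<rho> j ^ Poly_Mapping.lookup \<nu> j)"
  proof (rule prod_mono_strict)
    show "i \<in> ?A" using i by (simp add: in_keys_iff)
    show "\<rho> i ^ Poly_Mapping.lookup \<mu> i < \<rho> i ^ Poly_Mapping.lookup \<nu> i"
      using i admissible_gt_1[OF assms(1)] by (intro power_strict_increasing)
    fix j
    have pos: "0 < \<rho> j" using assms(1) by (simp add: admissible_def)
    show "0 < \<rho> j ^ Poly_Mapping.lookup \<nu> j" using pos by simp
    have "\<rho> j ^ Poly_Mapping.lookup \<mu> j \<le> \<rho> j ^ Poly_Mapping.lookup \<nu> j"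
      using assms(2) admissible_gt_1[OF assms(1), of j] by (intro power_increasing) auto
    then show "0 \<le> \<rho> j ^ Poly_Mapping.lookup \<mu> j \<and>
        \<rho> j ^ Poly_Mapping.lookup \<mu> j \<le> \<rho> j ^ Poly_Mapping.lookup \<nu> j"
      using pos by simp
  qed simp_all
  then show ?thesis using mpow_superset[OF _ sub] by (simp add: mpow_def)
qed

lemma ex_is_Lambda:
  assumes "admissible \<rho>" "n \<ge> 1"
  shows "\<exists>\<Lambda>. is_Lambda n \<rho> \<Lambda>"
proof -
  let ?a = "\<lambda>\<nu>. inverse (mpow \<rho> \<nu>)"
  define d where "d = (THE d. decreasing_rearrangement ?a d)"
  have "decreasing_rearrangement ?a d"
    unfolding d_def by (rule theI'[OF ex1_delta_sequence[OF assms(1)]])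
  then obtain e where e: "bij e" "d = ?a \<circ> e" "decseq d"
    unfolding decreasing_rearrangement_def by blast
  have delta: "delta \<rho> n = d (n - 1)" by (simp add: delta_def d_def)
  let ?L = "e ` {..<n}"
  have sub: "?a \<nu> \<ge> delta \<rho> n" if "\<nu> \<in> ?L" for \<nu>
  proof -
    from that obtain k where k: "k < n" "\<nu> = e k" by auto
    have "d (n - 1) \<le> d k" using decseqD[OF e(3), of k "n - 1"] k(1) by simp
    then show ?thesis using k e(2) by (simp add: delta)
  qed
  have sup: "\<nu> \<in> ?L" if gt: "?a \<nu> > delta \<rho> n" for \<nu>
  proof -
    obtain k where k: "\<nu> = e k" using e(1) by (meson bij_pointE)
    have "k < n"
    proof (rule ccontr)
      assume "\<not> k < n"
      then have "d k \<le> d (n - 1)" using decseqD[OF e(3), of "n - 1" k] by simp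
      then show False using gt k e(2) by (simp add: delta)
    qed
    then show ?thesis using k by simp
  qed
  have "lower_set ?L"
    unfolding lower_set_def
  proof (intro ballI allI impI)
    fix \<nu> \<mu> assume \<nu>: "\<nu> \<in> ?L"
      and le: "\<forall>j. Poly_Mapping.lookup \<mu> j \<le> Poly_Mapping.lookup \<nu> j"
    show "\<mu> \<in> ?L"
    proof (cases "\<mu> = \<nu>")
      case False
      then have "?a \<nu> < ?a \<mu>"
        using mpow_strict_mono[OF assms(1)] le mpow_pos[OF assms(1)]
        by (intro less_imp_inverse_less) auto
      then show ?thesis using sub[OF \<nu>] by (intro sup) simp
    qed (use \<nu> in simp)
  qed
  moreover have "card ?L = n"
    using e(1) by (subst card_image) (auto simp: bij_def inj_on_def)
  ultimately show ?thesis
    unfolding is_Lambda_def superlevel_def using sub sup by blast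
qed

end

theory Submission
  imports Defs "HOL-Computational_Algebra.Primes"
begin

text \<open>
  Writing \<open>b \<nu> = \<rho>\<^sup>\<nu> \<parallel>t\<^sub>\<nu>\<parallel>\<close>, the surrogate error of the unit ball outside \<open>\<Lambda>\<close> is the supremum of
  \<open>\<Sum>\<^bsub>\<nu>\<notin>\<Lambda>\<^esub> b \<nu> \<rho>\<^sup>-\<^sup>\<nu>\<close> over all nonnegative \<open>b\<close> in the unit ball of \<open>\<ell>\<^sub>p\<close>; finitely supported
  \<open>b\<close> suffice, and these come from polynomials.  An injection from the complement of \<open>\<Lambda>\<^bsub>n,\<rho>\<^esub>\<close>
  into the complement of \<open>\<Lambda>\<close> that does not decrease \<open>\<rho>\<^sup>-\<^sup>\<nu>\<close> carries \<open>b\<close> along and gives the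
  minimality.  For \<open>p \<ge> 1\<close> the supremum is a dual norm, so the sharp Hoelder inequality evaluates it.
  That polynomials are representable needs the uniqueness of expansions, which is the uniqueness of
  the coefficients of a Dirichlet series.
\<close>

subsection \<open>Uniqueness of expansions\<close>

text \<open>Unique prime factorization: with the \<open>j\<close>-th prime as \<open>w j\<close>,
  the exponents of a multi-index are the multiplicities of the primes in the product, so the product
  determines the multi-index.\<close>

lemma obtain_injective_weights:
  obtains w :: "nat \<Rightarrow> nat"
  where "\<And>j. w j > 0"
    and "inj (\<lambda>\<nu>::multiindex. \<Prod>j\<in>Poly_Mapping.keys \<nu>. w j ^ Poly_Mapping.lookup \<nu> j)"
proof
  let ?w = "enumerate {q::nat. prime q}"
  have prime: "prime (?w j)" for j
    using enumerate_in_set[OF primes_infinite, of j] by simp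
  show "?w j > 0" for j using prime[of j] by (rule prime_gt_0_nat)
  have inj: "inj ?w" by (rule inj_enumerate[OF primes_infinite])
  let ?m = "\<lambda>\<nu>::multiindex. \<Prod>j\<in>Poly_Mapping.keys \<nu>. ?w j ^ Poly_Mapping.lookup \<nu> j"
  have mult: "multiplicity (?w i) (?m \<nu>) = Poly_Mapping.lookup \<nu> i" for \<nu> i
  proof -
    let ?S = "?w ` Poly_Mapping.keys \<nu>"
    \<comment> \<open>Indexed by the primes themselves, the product is a prime factorization whose
      multiplicities can be read off.\<close>
    have "?m \<nu> = (\<Prod>x\<in>?S. x ^ Poly_Mapping.lookup \<nu> (inv ?w x))"
      using inj by (subst prod.reindex) (auto intro: inj_on_subset)
    then have "multiplicity (?w i) (?m \<nu>) =
        (if ?w i \<in> ?S then Poly_Mapping.lookup \<nu> (inv ?w (?w i)) else 0)"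
      using prime by (simp only:) (intro multiplicity_prod_prime_powers, auto)
    then show ?thesis using inj by (auto simp: inj_eq in_keys_iff inj_image_mem_iff)
  qed
  show "inj ?m"
    by (rule injI) (metis mult poly_mapping_eqI)
qed

text \<open>The decreasing rearrangement belonging to an admissible sequence comes with such a
  bijection; the sequence 2, 3, 4, ... serves as a sample.\<close>

lemma obtain_multiindex_enumeration:
  obtains e :: "nat \<Rightarrow> multiindex" where "bij e"
proof -
  have "admissible (\<lambda>j. real (j + 2))"
    unfolding admissible_def
    by (intro conjI filterlim_at_top_mono[OF filterlim_real_sequentially]) (auto simp: mono_def)
  then show ?thesis
    using ex1_delta_sequence that unfolding decreasing_rearrangement_def by blast
qed

section \<open>Expansions of differences and of polynomials\<close>

lemma abs_mpow_le_1:
  assumes "y \<in> cube" shows "\<bar>mpow y \<nu>\<bar> \<le> 1"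
  unfolding mpow_def abs_prod power_abs
  using assms by (intro prod_le_1) (auto simp: cube_def abs_le_iff intro!: power_le_one)

lemma has_expansion_tendsto:
  assumes "has_expansion t u" "bij e" "y \<in> cube"
  shows "(\<lambda>N. \<Sum>k<N. mpow y (e k) *\<^sub>R t (e k)) \<longlonglongrightarrow> u y"
  using assms by (intro tendsto_uniform_limitI[where S = cube]) (simp_all add: has_expansion_def)

lemma has_expansion_diff:
  assumes "has_expansion t u" "has_expansion s v"
  shows "has_expansion (\<lambda>\<nu>. t \<nu> - s \<nu>) (\<lambda>y. u y - v y)"
  unfolding has_expansion_def
proof (intro allI impI)
  fix e :: "nat \<Rightarrow> multiindex" assume "bij e"
  then have "uniform_limit cube (\<lambda>N y. (\<Sum>k<N. mpow y (e k) *\<^sub>R t (e k)) -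
      (\<Sum>k<N. mpow y (e k) *\<^sub>R s (e k))) (\<lambda>y. u y - v y) sequentially"
    using assms unfolding has_expansion_def by (intro uniform_limit_minus) auto
  then show "uniform_limit cube (\<lambda>N y. \<Sum>k<N. mpow y (e k) *\<^sub>R (t (e k) - s (e k)))
      (\<lambda>y. u y - v y) sequentially"
    by (simp add: sum_subtractf scaleR_diff_right)
qed

text \<open>Any enumeration has listed all of \<open>F\<close> after finitely many steps, and from
  then on the partial sums equal the polynomial at every point at once.\<close>

lemma has_expansion_poly:
  assumes "finite F"
  shows "has_expansion (\<lambda>\<nu>. if \<nu> \<in> F then c \<nu> else 0) (\<lambda>y. \<Sum>\<nu>\<in>F. mpow y \<nu> *\<^sub>R c \<nu>)"
  unfolding has_expansion_def
proof (intro allI impI)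
  fix e :: "nat \<Rightarrow> multiindex" assume e: "bij e"
  have inj: "inj_on e A" for A using e by (auto simp: bij_def intro: inj_on_subset)
  obtain M where M: "inv e ` F \<subseteq> {..<M}"
    using finite_nat_iff_bounded[of "inv e ` F"] assms by auto
  have eq: "(\<Sum>k<N. mpow y (e k) *\<^sub>R (if e k \<in> F then c (e k) else 0)) =
      (\<Sum>\<nu>\<in>F. mpow y \<nu> *\<^sub>R c \<nu>)" if "N \<ge> M" for N y
  proof -
    have "F \<subseteq> e ` {..<N}"
    proof
      fix \<nu> assume "\<nu> \<in> F"
      then have "inv e \<nu> < N" using M that by fastforce
      moreover have "\<nu> = e (inv e \<nu>)" using e by (simp add: bij_def surj_f_inv_f)
      ultimately show "\<nu> \<in> e ` {..<N}" by blast
    qed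
    moreover have "(\<Sum>k<N. mpow y (e k) *\<^sub>R (if e k \<in> F then c (e k) else 0)) =
        (\<Sum>\<nu>\<in>e ` {..<N}. mpow y \<nu> *\<^sub>R (if \<nu> \<in> F then c \<nu> else 0))"
      by (simp add: sum.reindex[OF inj])
    ultimately show ?thesis
      by (simp, intro sum.mono_neutral_cong_right) auto
  qed
  show "uniform_limit cube (\<lambda>N y. \<Sum>k<N. mpow y (e k) *\<^sub>R (if e k \<in> F then c (e k) else 0))
      (\<lambda>y. \<Sum>\<nu>\<in>F. mpow y \<nu> *\<^sub>R c \<nu>) sequentially"
  proof (rule uniform_limitI)
    fix \<epsilon> :: real assume "\<epsilon> > 0"
    then show "\<forall>\<^sub>F N in sequentially. \<forall>y\<in>cube.
        dist (\<Sum>k<N. mpow y (e k) *\<^sub>R (if e k \<in> F then c (e k) else 0))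
          (\<Sum>\<nu>\<in>F. mpow y \<nu> *\<^sub>R c \<nu>) < \<epsilon>"
      using eq by (intro eventually_sequentiallyI[of M]) simp
  qed
qed

section \<open>Coefficients of a Dirichlet series\<close>

text \<open>Distinct values of \<open>m\<close> select distinct terms of the convergent series of
  inverse squares, so the bound is uniform in \<open>A\<close>.\<close>

lemma sum_inverse_squares_le:
  fixes m :: "nat \<Rightarrow> nat"
  assumes "inj m"
  shows "(\<Sum>k\<in>A. inverse (real (m k)) ^ 2) \<le> suminf (\<lambda>j. inverse (real j ^ 2))"
proof (cases "finite A")
  case True
  have summable: "summable (\<lambda>j. inverse (real j ^ 2))"
    using inverse_power_summable[of 2, where 'a = real] by simp
  have "(\<Sum>k\<in>A. inverse (real (m k)) ^ 2) = (\<Sum>j\<in>m ` A. inverse (real j ^ 2))"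
    using assms by (subst sum.reindex) (auto intro: inj_on_subset simp: power_inverse)
  also have "\<dots> \<le> suminf (\<lambda>j. inverse (real j ^ 2))"
    using True by (intro sum_le_suminf summable) auto
  finally show ?thesis .
next
  \<comment> \<open>A sum over an infinite set is 0 by convention.\<close>
  case False
  have "summable (\<lambda>j. inverse (real j ^ 2))"
    using inverse_power_summable[of 2, where 'a = real] by simp
  then show ?thesis using False by (simp add: suminf_nonneg)
qed

text \<open>Induction on the value \<open>m k\<close>. Once the coefficients with smaller value
  vanish, the term of \<open>k0\<close> decays most slowly: multiplying the relation for the
  exponent \<open>s + 2\<close> by \<open>real m0 ^ (s + 2)\<close> leaves \<open>a k0\<close> plus
  a remainder of order \<open>(m0 / (m0 + 1)) ^ s\<close>, which tends to 0 as \<open>s\<close>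
  grows.\<close>

lemma dirichlet_series_eq_0:
  fixes a :: "nat \<Rightarrow> 'x::real_normed_vector" and m :: "nat \<Rightarrow> nat"
  assumes inj: "inj m" and pos: "\<And>k. m k > 0"
    and bound: "\<And>k. norm (a k) \<le> C"
    and lim: "\<And>s. (\<lambda>N. \<Sum>k<N. (inverse (real (m k)) ^ s) *\<^sub>R a k) \<longlonglongrightarrow> 0"
  shows "a k = 0"
proof (induction "m k" arbitrary: k rule: less_induct)
  case (less k0)
  define m0 where "m0 = m k0"
  define K where "K = suminf (\<lambda>j. inverse (real j ^ 2))"
  have C: "C \<ge> 0" using bound[of 0] norm_ge_zero order_trans by blast
  have m0: "m0 > 0" using pos by (simp add: m0_def)
  \<comment> \<open>Two of the \<open>s + 2\<close> powers are set aside for the convergent series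
    of inverse squares; the other \<open>s\<close> powers give the decay, since the surviving terms
    have \<open>m k\<close> at least \<open>m0 + 1\<close>.\<close>
  have partial: "norm (\<Sum>k\<in>{..<N}-{k0}. (inverse (real (m k)) ^ (s + 2)) *\<^sub>R a k)
      \<le> C * K * inverse (real (m0 + 1)) ^ s" for N s
  proof -
    have "norm (\<Sum>k\<in>{..<N}-{k0}. (inverse (real (m k)) ^ (s + 2)) *\<^sub>R a k)
        \<le> (\<Sum>k\<in>{..<N}-{k0}. C * inverse (real (m0 + 1)) ^ s * inverse (real (m k)) ^ 2)"
    proof (rule sum_norm_le)
      fix k assume k: "k \<in> {..<N} - {k0}"
      show "norm ((inverse (real (m k)) ^ (s + 2)) *\<^sub>R a k)
          \<le> C * inverse (real (m0 + 1)) ^ s * inverse (real (m k)) ^ 2"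
      proof (cases "m k < m0")
        case True
        then show ?thesis using less C by (simp add: m0_def)
      next
        case False
        have "m k \<noteq> m0" using k inj by (simp add: m0_def inj_eq)
        with False have "m0 + 1 \<le> m k" by simp
        then have "inverse (real (m k)) \<le> inverse (real (m0 + 1))"
          by (intro le_imp_inverse_le) auto
        then have "inverse (real (m k)) ^ s \<le> inverse (real (m0 + 1)) ^ s"
          by (intro power_mono) auto
        then have "norm (a k) * inverse (real (m k)) ^ s * inverse (real (m k)) ^ 2
            \<le> C * inverse (real (m0 + 1)) ^ s * inverse (real (m k)) ^ 2"
          using bound[of k] C by (intro mult_right_mono mult_mono) auto
        then show ?thesis by (simp add: power2_eq_square mult_ac)
      qed
    qed
    also have "\<dots> = C * inverse (real (m0 + 1)) ^ s * (\<Sum>k\<in>{..<N}-{k0}. inverse (real (m k)) ^ 2)"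
      by (simp add: sum_distrib_left)
    also have "\<dots> \<le> C * inverse (real (m0 + 1)) ^ s * K"
      unfolding K_def using sum_inverse_squares_le[OF inj] C by (intro mult_left_mono) auto
    finally show ?thesis by (simp add: mult_ac)
  qed
  have est: "norm (a k0) \<le> (C * K * real m0 ^ 2) * (real m0 / real (m0 + 1)) ^ s" for s
  proof -
    let ?S = "\<lambda>N. \<Sum>k<N. (inverse (real (m k)) ^ (s + 2)) *\<^sub>R a k"
    have "inverse (real m0) ^ (s + 2) * norm (a k0) \<le> C * K * inverse (real (m0 + 1)) ^ s"
    \<comment> \<open>The bound is written as the limit of itself minus a difference of norms that
      tends to 0 because \<open>?S N\<close> does.\<close>
    proof (rule LIMSEQ_le_const)
      have "(\<lambda>N. norm ((inverse (real m0) ^ (s + 2)) *\<^sub>R a k0 - ?S N))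
          \<longlonglongrightarrow> norm ((inverse (real m0) ^ (s + 2)) *\<^sub>R a k0 - 0)"
        by (intro tendsto_norm tendsto_diff tendsto_const lim)
      then have "(\<lambda>N. (C * K * inverse (real (m0 + 1)) ^ s) -
          (norm ((inverse (real m0) ^ (s + 2)) *\<^sub>R a k0 - ?S N) -
            norm ((inverse (real m0) ^ (s + 2)) *\<^sub>R a k0 - 0)))
          \<longlonglongrightarrow> (C * K * inverse (real (m0 + 1)) ^ s) -
            (norm ((inverse (real m0) ^ (s + 2)) *\<^sub>R a k0 - 0) -
            norm ((inverse (real m0) ^ (s + 2)) *\<^sub>R a k0 - 0))"
        by (intro tendsto_diff tendsto_const)
      then show "(\<lambda>N. (C * K * inverse (real (m0 + 1)) ^ s) -
          (norm ((inverse (real m0) ^ (s + 2)) *\<^sub>R a k0 - ?S N) -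
            norm ((inverse (real m0) ^ (s + 2)) *\<^sub>R a k0)))
          \<longlonglongrightarrow> C * K * inverse (real (m0 + 1)) ^ s"
        by simp
      show "\<exists>N. \<forall>n\<ge>N. inverse (real m0) ^ (s + 2) * norm (a k0)
        \<le> (C * K * inverse (real (m0 + 1)) ^ s) -
          (norm ((inverse (real m0) ^ (s + 2)) *\<^sub>R a k0 - ?S n) -
            norm ((inverse (real m0) ^ (s + 2)) *\<^sub>R a k0))"
      \<comment> \<open>From \<open>Suc k0\<close> on, the partial sum contains the term of
        \<open>k0\<close>, and subtracting it leaves exactly the sum estimated in
        \<open>partial\<close>.\<close>
      proof (intro exI[of _ "Suc k0"] allI impI)
        fix N assume "Suc k0 \<le> N"
        then have "?S N = (inverse (real m0) ^ (s + 2)) *\<^sub>R a k0 +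
            (\<Sum>k\<in>{..<N}-{k0}. (inverse (real (m k)) ^ (s + 2)) *\<^sub>R a k)"
          by (subst sum.remove[of _ k0]) (auto simp: m0_def)
        then show "inverse (real m0) ^ (s + 2) * norm (a k0)
          \<le> (C * K * inverse (real (m0 + 1)) ^ s) -
            (norm ((inverse (real m0) ^ (s + 2)) *\<^sub>R a k0 - ?S N) -
              norm ((inverse (real m0) ^ (s + 2)) *\<^sub>R a k0))"
          using partial[where N = N and s = s] by simp
      qed
    qed
    then have "real m0 ^ (s + 2) * (inverse (real m0) ^ (s + 2) * norm (a k0))
        \<le> real m0 ^ (s + 2) * (C * K * inverse (real (m0 + 1)) ^ s)"
      by (intro mult_left_mono) auto
    moreover have "real m0 ^ (s + 2) * (inverse (real m0) ^ (s + 2) * norm (a k0)) = norm (a k0)"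
    proof -
      have "(real m0 * inverse (real m0)) ^ (s + 2) = 1" using m0 by simp
      then have "real m0 ^ (s + 2) * inverse (real m0) ^ (s + 2) = 1"
        by (simp only: power_mult_distrib)
      then show ?thesis by (simp only: mult_1 flip: mult.assoc)
    qed
    moreover have "real m0 ^ (s + 2) * (C * K * inverse (real (m0 + 1)) ^ s) =
        (C * K * real m0 ^ 2) * (real m0 / real (m0 + 1)) ^ s"
      by (simp only: power_add divide_inverse power_mult_distrib mult_ac)
    ultimately show ?thesis by (simp only:)
  qed
  have "(\<lambda>s. (C * K * real m0 ^ 2) * (real m0 / real (m0 + 1)) ^ s) \<longlonglongrightarrow> (C * K * real m0 ^ 2) * 0"
    by (intro tendsto_intros LIMSEQ_realpow_zero) auto
  then have "norm (a k0) \<le> (C * K * real m0 ^ 2) * 0"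
    using est by (intro LIMSEQ_le_const[of _ _ "norm (a k0)"]) auto
  then show ?case by simp
qed

text \<open>At the points \<open>y\<^sub>j = w\<^sub>j\<^sup>-\<^sup>s\<close> with \<open>w\<^sub>j\<close> the primes, the power series becomes a Dirichlet
  series in \<open>s\<close>, whose coefficients are determined by letting \<open>s\<close> tend to infinity.\<close>

lemma has_expansion_0:
  fixes t :: "multiindex \<Rightarrow> 'x::real_normed_vector"
  assumes "has_expansion t (\<lambda>_. 0)"
  shows "t = (\<lambda>_. 0)"
proof
  fix \<nu>
  obtain w :: "nat \<Rightarrow> nat" where w: "\<And>j. w j > 0"
    and inj: "inj (\<lambda>\<nu>::multiindex. \<Prod>j\<in>Poly_Mapping.keys \<nu>. w j ^ Poly_Mapping.lookup \<nu> j)"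
    using obtain_injective_weights by blast
  obtain e :: "nat \<Rightarrow> multiindex" where e: "bij e" using obtain_multiindex_enumeration by blast
  define m where "m \<nu> = (\<Prod>j\<in>Poly_Mapping.keys \<nu>. w j ^ Poly_Mapping.lookup \<nu> j)"
    for \<nu> :: multiindex
  have cube: "(\<lambda>j. inverse (real (w j)) ^ s) \<in> cube" for s
  proof -
    have "0 \<le> inverse (real (w j)) ^ s \<and> inverse (real (w j)) ^ s \<le> 1" for j
      using w[of j] by (auto intro!: power_le_one simp: inverse_le_1_iff)
    then show ?thesis unfolding cube_def by (auto intro: order_trans[of _ 0])
  qed
  have mpow_eq: "mpow (\<lambda>j. inverse (real (w j)) ^ s) \<nu> = inverse (real (m \<nu>)) ^ s" for s \<nu>
  proof -
    have "mpow (\<lambda>j. inverse (real (w j)) ^ s) \<nu> =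
        (\<Prod>j\<in>Poly_Mapping.keys \<nu>. (inverse (real (w j)) ^ Poly_Mapping.lookup \<nu> j) ^ s)"
      unfolding mpow_def by (simp add: mult.commute flip: power_mult)
    also have "\<dots> = (\<Prod>j\<in>Poly_Mapping.keys \<nu>. inverse (real (w j ^ Poly_Mapping.lookup \<nu> j))) ^ s"
      by (simp add: prod_power_distrib power_inverse)
    also have "\<dots> = inverse (real (m \<nu>)) ^ s"
      using prod_inversef[of "\<lambda>j. real (w j ^ Poly_Mapping.lookup \<nu> j)" "Poly_Mapping.keys \<nu>"]
      by (simp only: m_def of_nat_prod o_def)
    finally show ?thesis .
  qed
  have lim: "(\<lambda>N. \<Sum>k<N. (inverse (real (m (e k))) ^ s) *\<^sub>R t (e k)) \<longlonglongrightarrow> 0" for s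
    using has_expansion_tendsto[OF assms e cube[of s]] by (simp only: mpow_eq)
  \<comment> \<open>At \<open>s = 0\<close> every coordinate is 1, so the series of the coefficients
    itself converges; hence its terms are bounded.\<close>
  have "summable (\<lambda>k. t (e k))"
    using lim[of 0] by (auto simp: summable_def sums_def)
  then have "Bseq (\<lambda>k. t (e k))"
    by (intro convergent_imp_Bseq convergentI) (rule summable_LIMSEQ_zero)
  then obtain C where C: "\<And>k. norm (t (e k)) \<le> C" by (auto simp: Bseq_def)
  have "t (e k) = 0" for k
  proof (rule dirichlet_series_eq_0[where a = "\<lambda>k. t (e k)" and m = "\<lambda>k. m (e k)"])
    show "inj (\<lambda>k. m (e k))"
      using inj_compose[OF inj bij_is_inj[OF e]] by (simp add: o_def m_def)
    show "m (e k) > 0" for k using w by (simp add: m_def prod_pos)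
  qed (rule C lim)+
  then show "t \<nu> = 0" using e by (metis bij_pointE)
qed

section \<open>Coefficients of representable functions\<close>

text \<open>The difference of two expansions of \<open>u\<close> expands 0. As a consequence,
  exhibiting any one expansion proves representability and identifies \<open>coeffs\<close>.\<close>

lemma has_expansion_unique:
  assumes "has_expansion t u" "has_expansion s u"
  shows "t = s"
proof -
  have "(\<lambda>\<nu>. t \<nu> - s \<nu>) = (\<lambda>_. 0)"
    using has_expansion_diff[OF assms] by (intro has_expansion_0) simp
  then show ?thesis by (simp add: fun_eq_iff)
qed

lemma has_expansion_representable:
  assumes "has_expansion t u" shows "representable u"
  unfolding representable_def using assms has_expansion_unique by blast

lemma coeffs_eq:
  assumes "has_expansion t u" shows "coeffs u = t"
  unfolding coeffs_def using assms has_expansion_unique by blast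

lemma has_expansion_coeffs:
  assumes "representable u" shows "has_expansion (coeffs u) u"
  unfolding coeffs_def using assms unfolding representable_def by (rule theI')

subsection \<open>Duality of the sequence spaces\<close>

lemma sum_le_infsum_ennreal:
  fixes f :: "'i \<Rightarrow> ennreal"
  assumes "finite F" "F \<subseteq> I" shows "sum f F \<le> infsum f I"
  using assms by (subst nonneg_infsum_complete) (auto intro: SUP_upper)

text \<open>A sum of nonnegative terms is the supremum of its finite partial sums; this reduces
  upper bounds to finite index sets.\<close>

lemma infsum_le_iff_ennreal:
  fixes f :: "'i \<Rightarrow> ennreal"
  shows "infsum f I \<le> c \<longleftrightarrow> (\<forall>F. finite F \<longrightarrow> F \<subseteq> I \<longrightarrow> sum f F \<le> c)"
  by (subst nonneg_infsum_complete) (auto simp: SUP_le_iff)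

lemma infsum_mono_ennreal:
  fixes f g :: "'i \<Rightarrow> ennreal"
  assumes "\<And>i. i \<in> I \<Longrightarrow> f i \<le> g i" shows "infsum f I \<le> infsum g I"
  using assms by (intro infsum_mono nonneg_summable_on_complete) auto

lemma infsum_mono_set_ennreal:
  fixes f :: "'i \<Rightarrow> ennreal"
  assumes "I \<subseteq> J" shows "infsum f I \<le> infsum f J"
  using assms by (intro infsum_mono_neutral nonneg_summable_on_complete) auto

section \<open>Rules for the sequence quasi-norms\<close>

lemma ennreal_powr_mono:
  assumes "s \<le> s'" "0 \<le> r" shows "ennreal_powr s r \<le> ennreal_powr s' r"
proof (cases "s' = \<infinity>")
  case False
  then have "s \<noteq> \<infinity>" "enn2real s \<le> enn2real s'"
    using assms by (auto simp: top_unique less_top intro: enn2real_mono)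
  then show ?thesis
    using False assms by (auto simp: ennreal_powr_def intro!: ennreal_leI powr_mono2)
qed (simp add: ennreal_powr_def)

lemma ennreal_powr_1: "ennreal_powr s 1 = s"
  by (cases s) (auto simp: ennreal_powr_def)

lemma ennreal_powr_le_iff:
  assumes "0 < r" "0 \<le> B"
  shows "ennreal_powr s (1 / r) \<le> ennreal B \<longleftrightarrow> s \<le> ennreal (B powr r)"
proof (cases s)
  case (real x)
  have "x powr (1 / r) \<le> B \<longleftrightarrow> x \<le> B powr r"
  proof
    assume "x powr (1 / r) \<le> B"
    then have "(x powr (1 / r)) powr r \<le> B powr r" using assms by (intro powr_mono2) auto
    then show "x \<le> B powr r" using assms real by (simp add: powr_powr)
  next
    assume "x \<le> B powr r"
    then have "x powr (1 / r) \<le> (B powr r) powr (1 / r)" using assms real by (intro powr_mono2) auto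
    then show "x powr (1 / r) \<le> B" using assms by (simp add: powr_powr)
  qed
  then show ?thesis using assms real by (simp add: ennreal_powr_def)
qed (simp add: ennreal_powr_def top_unique)

text \<open>Turns a bound on a possibly infinite quasi-norm into inequalities between finite real
  sums, where the real Hoelder inequality applies.\<close>

lemma lp_norm_le_iff:
  assumes "0 < r" "0 \<le> B"
  shows "lp_norm (ennreal r) a I \<le> ennreal B \<longleftrightarrow>
    (\<forall>F. finite F \<longrightarrow> F \<subseteq> I \<longrightarrow> (\<Sum>i\<in>F. \<bar>a i\<bar> powr r) \<le> B powr r)"
  using assms
  by (simp add: lp_norm_def ennreal_powr_le_iff infsum_le_iff_ennreal sum_nonneg)

lemma lp_norm_infinity: "lp_norm \<infinity> a I = (SUP i\<in>I. ennreal \<bar>a i\<bar>)"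
  by (simp add: lp_norm_def)

lemma lp_norm_1: "lp_norm 1 a I = (\<Sum>\<^sub>\<infinity>i\<in>I. ennreal \<bar>a i\<bar>)"
  by (simp add: lp_norm_def ennreal_powr_1)

lemma lp_norm_mono:
  assumes "\<And>i. i \<in> I \<Longrightarrow> \<bar>a i\<bar> \<le> \<bar>b i\<bar>"
  shows "lp_norm p a I \<le> lp_norm p b I"
proof (cases "p = \<infinity>")
  case True
  then show ?thesis
    using assms by (auto simp: lp_norm_def intro!: SUP_mono ennreal_leI)
next
  case False
  then show ?thesis
    using assms
    by (auto simp: lp_norm_def intro!: ennreal_powr_mono infsum_mono_ennreal ennreal_leI powr_mono2)
qed

lemma lp_norm_mono_set:
  assumes "I \<subseteq> J" shows "lp_norm p a I \<le> lp_norm p a J"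
  using assms
  by (auto simp: lp_norm_def intro!: ennreal_powr_mono infsum_mono_set_ennreal SUP_subset_mono)

lemma lp_norm_reindex:
  assumes "inj_on h I" shows "lp_norm p a (h ` I) = lp_norm p (\<lambda>i. a (h i)) I"
  using assms by (simp add: lp_norm_def infsum_reindex o_def image_image)

lemma lp_norm_neutral:
  assumes "I \<subseteq> J" "\<And>i. i \<in> J - I \<Longrightarrow> a i = 0"
  shows "lp_norm p a I = lp_norm p a J"
proof (cases "p = \<infinity>")
  case True
  have "(SUP i\<in>J. ennreal \<bar>a i\<bar>) \<le> (SUP i\<in>I. ennreal \<bar>a i\<bar>)"
  proof (rule SUP_least)
    fix i assume "i \<in> J"
    then show "ennreal \<bar>a i\<bar> \<le> (SUP i\<in>I. ennreal \<bar>a i\<bar>)"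
      using assms(2)[of i] by (cases "i \<in> I") (auto intro: SUP_upper)
  qed
  then show ?thesis
    using True lp_norm_mono_set[OF assms(1), of p a] by (simp add: lp_norm_def)
next
  case False
  have "infsum (\<lambda>i. ennreal (\<bar>a i\<bar> powr r)) I = infsum (\<lambda>i. ennreal (\<bar>a i\<bar> powr r)) J" for r
    using assms by (intro infsum_cong_neutral) auto
  then show ?thesis using False by (simp add: lp_norm_def)
qed

section \<open>Hoelder duality\<close>

text \<open>In \<open>ennreal\<close>, 1 divided by \<infinity> is 0 and 1 divided by 0 is
  \<infinity>. So the equation covers both endpoint pairs and excludes \<open>q = 0\<close>; the
  remaining exponents are real.\<close>

lemma conjugate_exponents:
  fixes p q :: ennreal
  assumes "1 \<le> p" "1 / p + 1 / q = 1"
  obtains "p = 1" "q = \<infinity>" | "p = \<infinity>" "q = 1"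
    | r s where "p = ennreal r" "q = ennreal s" "1 < r" "1 < s" "1 / r + 1 / s = 1"
proof (cases p)
  case top
  then have "1 / q = 1" using assms by simp
  have "q = 1"
  proof (cases q)
    case (real x)
    with \<open>1 / q = 1\<close> have "x > 0" by (cases "x = 0") auto
    then show ?thesis
      using \<open>1 / q = 1\<close> real by (simp add: divide_ennreal flip: ennreal_1)
  qed (use \<open>1 / q = 1\<close> in simp)
  then show ?thesis using top that by simp
next
  case (real r)
  then have r: "1 \<le> r" using assms(1) by simp
  have p1: "1 / p = ennreal (1 / r)"
    using real r by (simp add: divide_ennreal flip: ennreal_1)
  show ?thesis
  proof (cases q)
    case top
    then have "r = 1" using assms(2) p1 r by simp
    then show ?thesis using real top that by simp
  next
    case (real s)
    have s: "0 < s"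
    proof (rule ccontr)
      assume "\<not> 0 < s"
      then have "q = 0" using real by simp
      then show False using assms(2) by simp
    qed
    then have "1 / q = ennreal (1 / s)"
      using real by (simp add: divide_ennreal flip: ennreal_1)
    then have "ennreal (1 / r + 1 / s) = ennreal 1"
      using assms(2) p1 r s by simp
    then have eq: "1 / r + 1 / s = 1" using r s by (subst (asm) ennreal_inj) auto
    moreover have "r \<noteq> 1" using eq s by auto
    moreover have "1 < s"
    proof -
      have "1 / s < 1" using eq r by (smt (verit) divide_pos_pos)
      then show ?thesis using s by simp
    qed
    ultimately show ?thesis using that(3)[of r s] r real \<open>p = ennreal r\<close> by simp
  qed
qed

text \<open>Young's inequality, applied termwise after scaling \<open>a\<close> by \<open>A\<close>;
  the case \<open>A = 0\<close> is separate because of the division.\<close>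

lemma Hoelder_sum_le:
  fixes a b :: "'i \<Rightarrow> real"
  assumes rs: "1 < r" "1 < s" "1 / r + 1 / s = 1"
    and nonneg: "\<And>i. 0 \<le> a i" "\<And>i. 0 \<le> b i" "0 \<le> A"
    and F: "finite F"
    and b: "(\<Sum>i\<in>F. b i powr r) \<le> 1" and a: "(\<Sum>i\<in>F. a i powr s) \<le> A powr s"
  shows "(\<Sum>i\<in>F. b i * a i) \<le> A"
proof (cases "A = 0")
  case True
  then have "(\<Sum>i\<in>F. a i powr s) = 0"
    using a by (intro antisym sum_nonneg) auto
  then have "\<forall>i\<in>F. a i = 0" using F by (subst (asm) sum_nonneg_eq_0_iff) auto
  then show ?thesis using True by simp
next
  case False
  with nonneg have A: "A > 0" by simp
  have "(\<Sum>i\<in>F. b i * (a i / A)) \<le> (\<Sum>i\<in>F. b i powr r / r + (a i / A) powr s / s)"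
    using rs nonneg by (intro sum_mono Youngs_inequality) auto
  also have "\<dots> = (\<Sum>i\<in>F. b i powr r) / r + (\<Sum>i\<in>F. a i powr s) / A powr s / s"
    using nonneg by (simp add: sum.distrib powr_divide sum_divide_distrib)
  also have "\<dots> \<le> 1 / r + 1 / s"
    using rs A a b by (intro add_mono divide_right_mono) auto
  finally have "(\<Sum>i\<in>F. b i * a i) / A \<le> 1"
    using rs by (simp add: sum_divide_distrib)
  then show ?thesis using A by simp
qed

text \<open>One direction is Hoelder on finite sets. For the other, the extremal sequence of the
  restriction of \<open>a\<close> to a finite set \<open>F\<close> is tested, which also covers an
  infinite norm of \<open>a\<close>.\<close>

lemma lp_norm_dual_aux:
  fixes a :: "'i \<Rightarrow> real"
  assumes rs: "1 < r" "1 < s" "1 / r + 1 / s = 1" and a: "\<And>i. 0 \<le> a i"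
  shows "(SUP b\<in>{b. (\<forall>i. 0 \<le> b i) \<and> lp_norm (ennreal r) b UNIV \<le> 1}.
    \<Sum>\<^sub>\<infinity>i\<in>I. ennreal (b i * a i)) = lp_norm (ennreal s) a I" (is "?L = ?R")
proof (rule antisym)
  show "?L \<le> ?R"
  proof (cases ?R)
    case (real A)
    have "(\<Sum>\<^sub>\<infinity>i\<in>I. ennreal (b i * a i)) \<le> ennreal A"
      if b: "\<forall>i. 0 \<le> b i" "lp_norm (ennreal r) b UNIV \<le> 1" for b
      unfolding infsum_le_iff_ennreal
    proof (intro allI impI)
      fix F assume F: "finite F" "F \<subseteq> I"
      have "lp_norm (ennreal r) b UNIV \<le> ennreal 1" using b by simp
      then have "(\<Sum>i\<in>F. b i powr r) \<le> 1"
        using F b rs by (subst (asm) lp_norm_le_iff) auto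
      moreover have "(\<Sum>i\<in>F. a i powr s) \<le> A powr s"
        using lp_norm_le_iff[of s A a I] F a rs real by auto
      ultimately have "(\<Sum>i\<in>F. b i * a i) \<le> A"
        using rs a b real F by (intro Hoelder_sum_le[of r s]) auto
      then show "(\<Sum>i\<in>F. ennreal (b i * a i)) \<le> ennreal A"
        using a b by (simp add: ennreal_leI)
    qed
    then show ?thesis using real by (auto intro: SUP_least)
  qed simp
  show "?R \<le> ?L"
  proof (cases ?L)
    case (real \<beta>)
    have "(\<Sum>i\<in>F. a i powr s) \<le> \<beta> powr s" if F: "finite F" "F \<subseteq> I" for F
    proof (cases "(\<Sum>i\<in>F. a i powr s) = 0")
      case False
      define T where "T = (\<Sum>i\<in>F. a i powr s)"
      have T: "T > 0" using False by (simp add: T_def less_le sum_nonneg)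
      \<comment> \<open>The equality case of Hoelder: since \<open>(s - 1) * r = s\<close>, the
        powers \<open>b i powr r\<close> equal \<open>a i powr s / T\<close> and sum to 1, while the
        pairing with \<open>a\<close> is \<open>T powr (1 - 1 / r)\<close>, that is
        \<open>T powr (1 / s)\<close>.\<close>
      define b where "b i = (if i \<in> F then a i powr (s - 1) / T powr (1 / r) else 0)" for i
      have exps: "(s - 1) * r = s" "1 - 1 / r = 1 / s"
        using rs by (simp_all add: field_simps)
      have bnn: "0 \<le> b i" for i by (simp add: b_def)
      have bF: "(\<Sum>i\<in>F. b i powr r) = 1"
      proof -
        have "(\<Sum>i\<in>F. b i powr r) = (\<Sum>i\<in>F. a i powr s / T)"
          using T rs exps by (intro sum.cong) (auto simp: b_def powr_divide powr_powr)
        then show ?thesis using T by (simp add: T_def flip: sum_divide_distrib)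
      qed
      have "lp_norm (ennreal r) b UNIV = lp_norm (ennreal r) b F"
        by (rule lp_norm_neutral[symmetric]) (auto simp: b_def)
      also have "\<dots> \<le> ennreal 1"
      proof (subst lp_norm_le_iff)
        show "\<forall>G. finite G \<longrightarrow> G \<subseteq> F \<longrightarrow> (\<Sum>i\<in>G. \<bar>b i\<bar> powr r) \<le> 1 powr r"
        proof (intro allI impI)
          fix G assume "G \<subseteq> F"
          then have "(\<Sum>i\<in>G. \<bar>b i\<bar> powr r) \<le> (\<Sum>i\<in>F. \<bar>b i\<bar> powr r)"
            using F by (intro sum_mono2) auto
          then show "(\<Sum>i\<in>G. \<bar>b i\<bar> powr r) \<le> 1 powr r" using bF bnn by simp
        qed
      qed (use rs in auto)
      finally have b1: "lp_norm (ennreal r) b UNIV \<le> 1" by simp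
      have "T powr (1 / s) = T / T powr (1 / r)"
        using T by (simp flip: powr_diff exps(2)) (simp add: powr_diff)
      also have "\<dots> = (\<Sum>i\<in>F. b i * a i)"
      proof -
        have "a i powr (s - 1) * a i = a i powr s" for i
          using a[of i] by (cases "a i = 0") (simp_all add: powr_diff)
        then show ?thesis by (simp add: b_def T_def sum_divide_distrib)
      qed
      finally have "ennreal (T powr (1 / s)) = (\<Sum>i\<in>F. ennreal (b i * a i))"
        using a bnn by simp
      also have "\<dots> \<le> (\<Sum>\<^sub>\<infinity>i\<in>I. ennreal (b i * a i))"
        using F by (rule sum_le_infsum_ennreal)
      also have "\<dots> \<le> ?L" using b1 bnn by (intro SUP_upper) auto
      finally have "T powr (1 / s) \<le> \<beta>" using real by simp
      then have "(T powr (1 / s)) powr s \<le> \<beta> powr s" using rs by (intro powr_mono2) auto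
      then show ?thesis using T rs by (simp add: powr_powr T_def)
    qed simp
    then have "?R \<le> ennreal \<beta>" using rs real a by (subst lp_norm_le_iff) auto
    then show ?thesis using real by simp
  next
    case top
    then show ?thesis by (simp only: top_greatest)
  qed
qed

text \<open>At the endpoints the test sequences are explicit: unit masses for \<open>p = 1\<close>,
  the constant sequence 1 for \<open>p = \<infinity>\<close>.\<close>

lemma lp_norm_dual:
  fixes a :: "'i \<Rightarrow> real"
  assumes "1 \<le> p" "1 / p + 1 / q = 1" and a: "\<And>i. 0 \<le> a i"
  shows "(SUP b\<in>{b. (\<forall>i. 0 \<le> b i) \<and> lp_norm p b UNIV \<le> 1}. \<Sum>\<^sub>\<infinity>i\<in>I. ennreal (b i * a i)) =
    lp_norm q a I" (is "?L = _")
  using assms(1,2)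
proof (cases rule: conjugate_exponents)
  case 1
  have "?L \<le> lp_norm \<infinity> a I"
  proof (intro SUP_least, clarify)
    fix b :: "'i \<Rightarrow> real" assume b: "\<forall>i. 0 \<le> b i" "lp_norm p b UNIV \<le> 1"
    show "(\<Sum>\<^sub>\<infinity>i\<in>I. ennreal (b i * a i)) \<le> lp_norm \<infinity> a I"
      unfolding infsum_le_iff_ennreal
    proof (intro allI impI)
      fix F assume F: "finite F" "F \<subseteq> I"
      have "(\<Sum>i\<in>F. ennreal (b i * a i)) \<le> (\<Sum>i\<in>F. ennreal (b i) * lp_norm \<infinity> a I)"
      proof (rule sum_mono)
        fix i assume "i \<in> F"
        then have "ennreal (a i) \<le> lp_norm \<infinity> a I"
          using F a unfolding lp_norm_infinity by (intro SUP_upper2[of i]) auto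
        then show "ennreal (b i * a i) \<le> ennreal (b i) * lp_norm \<infinity> a I"
          using a b by (simp add: ennreal_mult mult_left_mono)
      qed
      also have "\<dots> = (\<Sum>i\<in>F. ennreal (b i)) * lp_norm \<infinity> a I"
        by (rule sum_distrib_right[symmetric])
      also have "\<dots> \<le> 1 * lp_norm \<infinity> a I"
      proof (rule mult_right_mono)
        have "(\<Sum>i\<in>F. ennreal (b i)) \<le> (\<Sum>\<^sub>\<infinity>i. ennreal \<bar>b i\<bar>)"
          using sum_le_infsum_ennreal[OF F(1) subset_UNIV, of "\<lambda>i. ennreal \<bar>b i\<bar>"] b by simp
        also have "\<dots> \<le> 1" using b 1 by (simp add: lp_norm_1)
        finally show "(\<Sum>i\<in>F. ennreal (b i)) \<le> 1" .
      qed simp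
      finally show "(\<Sum>i\<in>F. ennreal (b i * a i)) \<le> lp_norm \<infinity> a I" by simp
    qed
  qed
  moreover have "lp_norm \<infinity> a I \<le> ?L"
    unfolding lp_norm_infinity
  proof (rule SUP_least)
    fix i assume i: "i \<in> I"
    let ?b = "\<lambda>j. if j = i then 1 else 0 :: real"
    have "lp_norm p ?b UNIV = lp_norm p ?b {i}"
      by (rule lp_norm_neutral[symmetric]) auto
    then have "lp_norm p ?b UNIV \<le> 1" using 1 by (simp add: lp_norm_1)
    then have "(\<Sum>\<^sub>\<infinity>j\<in>I. ennreal (?b j * a j)) \<le> ?L" by (intro SUP_upper) auto
    moreover have "ennreal \<bar>a i\<bar> \<le> (\<Sum>\<^sub>\<infinity>j\<in>I. ennreal (?b j * a j))"
      using sum_le_infsum_ennreal[of "{i}" I "\<lambda>j. ennreal (?b j * a j)"] i a by simp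
    ultimately show "ennreal \<bar>a i\<bar> \<le> ?L" by (rule order_trans[rotated])
  qed
  ultimately show ?thesis using 1 by simp
next
  case 2
  have "?L \<le> lp_norm 1 a I"
  proof (intro SUP_least, clarify)
    fix b :: "'i \<Rightarrow> real" assume b: "\<forall>i. 0 \<le> b i" "lp_norm p b UNIV \<le> 1"
    have "b i \<le> 1" for i
    proof -
      have "ennreal \<bar>b i\<bar> \<le> 1"
        using b(2) unfolding 2 lp_norm_infinity SUP_le_iff by blast
      then show ?thesis using b(1) by simp
    qed
    then show "(\<Sum>\<^sub>\<infinity>i\<in>I. ennreal (b i * a i)) \<le> lp_norm 1 a I"
      unfolding lp_norm_1 using a b
      by (intro infsum_mono_ennreal ennreal_leI) (auto intro!: mult_left_le_one_le)
  qed
  moreover have "lp_norm p (\<lambda>_. 1) (UNIV :: 'i set) \<le> 1"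
    unfolding 2 lp_norm_infinity by simp
  then have "(\<Sum>\<^sub>\<infinity>i\<in>I. ennreal (1 * a i)) \<le> ?L"
    by (intro SUP_upper) simp
  ultimately show ?thesis using 2 a by (simp add: lp_norm_1)
next
  case (3 r s)
  then show ?thesis using lp_norm_dual_aux[of r s a I] a by simp
qed

subsection \<open>Errors on the unit ball\<close>

text \<open>Monomials are at most 1 in modulus on the cube, so the triangle inequality bounds every
  partial sum, and the bound passes to the limit.\<close>

lemma linf_norm_le_star_norm:
  assumes "representable u" shows "linf_norm u \<le> star_norm u"
  unfolding linf_norm_def
proof (rule SUP_least)
  fix y :: "nat \<Rightarrow> real" assume y: "y \<in> cube"
  obtain e :: "nat \<Rightarrow> multiindex" where e: "bij e"
    using obtain_multiindex_enumeration by blast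
  let ?t = "coeffs u"
  show "ennreal (norm (u y)) \<le> star_norm u"
  proof (cases "star_norm u")
    case (real S)
    have "norm (\<Sum>k<N. mpow y (e k) *\<^sub>R ?t (e k)) \<le> S" for N
    proof -
      have "norm (\<Sum>k<N. mpow y (e k) *\<^sub>R ?t (e k)) \<le> (\<Sum>k<N. norm (?t (e k)))"
        using abs_mpow_le_1[OF y] by (intro sum_norm_le) (simp add: mult_left_le_one_le)
      also have "\<dots> = (\<Sum>\<nu>\<in>e ` {..<N}. norm (?t \<nu>))"
        using e by (subst sum.reindex) (auto simp: bij_def intro: inj_on_subset)
      also have "\<dots> \<le> S"
        using sum_le_infsum_ennreal[of "e ` {..<N}" UNIV "\<lambda>\<nu>. ennreal (norm (?t \<nu>))"] real
        by (simp add: star_norm_def)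
      finally show ?thesis .
    qed
    moreover have "(\<lambda>N. norm (\<Sum>k<N. mpow y (e k) *\<^sub>R ?t (e k))) \<longlonglongrightarrow> norm (u y)"
      using has_expansion_tendsto[OF has_expansion_coeffs[OF assms] e y] by (rule tendsto_norm)
    ultimately have "norm (u y) \<le> S" by (intro LIMSEQ_le_const2) auto
    then show ?thesis using real by (simp add: ennreal_leI)
  next
    case top
    then show ?thesis by (simp only: top_greatest)
  qed
qed

lemma has_expansion_diff_poly:
  assumes "representable u" "finite \<Lambda>" "P = (\<lambda>y. \<Sum>\<nu>\<in>\<Lambda>. mpow y \<nu> *\<^sub>R c \<nu>)"
  shows "has_expansion (\<lambda>\<nu>. coeffs u \<nu> - (if \<nu> \<in> \<Lambda> then c \<nu> else 0)) (\<lambda>y. u y - P y)"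
  unfolding assms(3)
  by (intro has_expansion_diff has_expansion_coeffs has_expansion_poly assms(1,2))

lemma err_fun_le_star_err_fun:
  assumes "representable u" "finite \<Lambda>"
  shows "err_fun \<Lambda> u \<le> star_err_fun \<Lambda> u"
  unfolding err_fun_def star_err_fun_def
proof (rule INF_mono)
  fix P :: "(nat \<Rightarrow> real) \<Rightarrow> 'a" assume P: "P \<in> polys \<Lambda>"
  then have "representable (\<lambda>y. u y - P y)"
    using has_expansion_diff_poly[OF assms] has_expansion_representable by (auto simp: polys_def)
  then show "\<exists>Q\<in>polys \<Lambda>. linf_norm (\<lambda>y. u y - Q y) \<le> star_norm (\<lambda>y. u y - P y)"
    using P linf_norm_le_star_norm by blast
qed

text \<open>Subtracting a polynomial changes only the coefficients inside \<Lambda>. Truncating the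
  expansion makes these 0, and no choice affects the others.\<close>

lemma star_err_fun_eq:
  assumes "representable u" "finite \<Lambda>"
  shows "star_err_fun \<Lambda> u = (\<Sum>\<^sub>\<infinity>\<nu>\<in>-\<Lambda>. ennreal (norm (coeffs u \<nu>)))"
proof (rule antisym)
  let ?P = "\<lambda>y. \<Sum>\<nu>\<in>\<Lambda>. mpow y \<nu> *\<^sub>R coeffs u \<nu>"
  have "star_norm (\<lambda>y. u y - ?P y) = (\<Sum>\<^sub>\<infinity>\<nu>\<in>-\<Lambda>. ennreal (norm (coeffs u \<nu>)))"
    unfolding star_norm_def coeffs_eq[OF has_expansion_diff_poly[OF assms refl]]
    by (intro infsum_cong_neutral) auto
  moreover have "?P \<in> polys \<Lambda>" by (auto simp: polys_def)
  ultimately show "star_err_fun \<Lambda> u \<le> (\<Sum>\<^sub>\<infinity>\<nu>\<in>-\<Lambda>. ennreal (norm (coeffs u \<nu>)))"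
    using INF_lower[of ?P "polys \<Lambda>" "\<lambda>P. star_norm (\<lambda>y. u y - P y)"]
    by (simp add: star_err_fun_def)
next
  show "(\<Sum>\<^sub>\<infinity>\<nu>\<in>-\<Lambda>. ennreal (norm (coeffs u \<nu>))) \<le> star_err_fun \<Lambda> u"
    unfolding star_err_fun_def
  proof (rule INF_greatest)
    fix P :: "(nat \<Rightarrow> real) \<Rightarrow> 'a" assume "P \<in> polys \<Lambda>"
    then obtain c where P: "P = (\<lambda>y. \<Sum>\<nu>\<in>\<Lambda>. mpow y \<nu> *\<^sub>R c \<nu>)" by (auto simp: polys_def)
    have "(\<Sum>\<^sub>\<infinity>\<nu>\<in>-\<Lambda>. ennreal (norm (coeffs u \<nu>))) =
        (\<Sum>\<^sub>\<infinity>\<nu>\<in>-\<Lambda>. ennreal (norm (coeffs u \<nu> - (if \<nu> \<in> \<Lambda> then c \<nu> else 0))))"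
      by (intro infsum_cong) auto
    also have "\<dots> \<le> star_norm (\<lambda>y. u y - P y)"
      unfolding star_norm_def coeffs_eq[OF has_expansion_diff_poly[OF assms P]]
      by (intro infsum_mono_set_ennreal) auto
    finally show "(\<Sum>\<^sub>\<infinity>\<nu>\<in>-\<Lambda>. ennreal (norm (coeffs u \<nu>))) \<le> star_norm (\<lambda>y. u y - P y)" .
  qed
qed

section \<open>The surrogate error of the unit ball\<close>

lemma poly_mem_linf_space:
  "(\<lambda>y. \<Sum>\<nu>\<in>F. mpow y \<nu> *\<^sub>R c \<nu>) \<in> linf_space"
proof -
  have "norm (\<Sum>\<nu>\<in>F. mpow y \<nu> *\<^sub>R c \<nu>) \<le> (\<Sum>\<nu>\<in>F. norm (c \<nu>))" if "y \<in> cube" for y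
    using abs_mpow_le_1[OF that] by (intro sum_norm_le) (simp add: mult_left_le_one_le)
  then show ?thesis by (auto simp: linf_space_def bounded_iff)
qed

lemma B_ball_representable: "u \<in> B_ball \<rho> p \<Longrightarrow> representable u"
  by (simp add: B_ball_def B_space_def)

lemma err_set_le_star_err_set:
  assumes "finite \<Lambda>" "\<And>u. u \<in> K \<Longrightarrow> representable u"
  shows "err_set \<Lambda> K \<le> star_err_set \<Lambda> K"
  unfolding err_set_def star_err_set_def
proof (rule SUP_mono)
  fix u assume "u \<in> K"
  then show "\<exists>v\<in>K. err_fun \<Lambda> u \<le> star_err_fun \<Lambda> v"
    using assms by (intro bexI[of _ u] err_fun_le_star_err_fun)
qed

text \<open>The substitution is \<open>b \<nu> = mpow \<rho> \<nu> * norm (coeffs u \<nu>)\<close>.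
  Conversely, each finite partial sum for \<open>b\<close> is attained by a polynomial in the ball,
  so no convergence of a series built from \<open>b\<close> has to be checked.\<close>

lemma star_err_set_B_ball:
  assumes nonzero: "\<exists>x::'x::real_normed_vector. x \<noteq> 0"
    and adm: "admissible \<rho>" and \<Lambda>: "finite \<Lambda>"
  shows "star_err_set \<Lambda> (B_ball \<rho> p :: ((nat \<Rightarrow> real) \<Rightarrow> 'x) set) =
    (SUP b\<in>{b. (\<forall>\<nu>. 0 \<le> b \<nu>) \<and> lp_norm p b UNIV \<le> 1}.
      \<Sum>\<^sub>\<infinity>\<nu>\<in>-\<Lambda>. ennreal (b \<nu> * inverse (mpow \<rho> \<nu>)))" (is "?L = ?R")
proof (rule antisym)
  note pos = mpow_pos[OF adm]
  show "?L \<le> ?R"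
    unfolding star_err_set_def
  proof (rule SUP_least)
    fix u :: "(nat \<Rightarrow> real) \<Rightarrow> 'x" assume u: "u \<in> B_ball \<rho> p"
    let ?b = "\<lambda>\<nu>. mpow \<rho> \<nu> * norm (coeffs u \<nu>)"
    have eq: "norm (coeffs u \<nu>) = ?b \<nu> * inverse (mpow \<rho> \<nu>)" for \<nu>
      using pos[of \<nu>] by simp
    have "star_err_fun \<Lambda> u = (\<Sum>\<^sub>\<infinity>\<nu>\<in>-\<Lambda>. ennreal (?b \<nu> * inverse (mpow \<rho> \<nu>)))"
      unfolding star_err_fun_eq[OF B_ball_representable[OF u] \<Lambda>]
      by (intro infsum_cong arg_cong[where f = ennreal] eq)
    also have "\<dots> \<le> ?R"
      using u pos by (intro SUP_upper) (auto simp: B_ball_def B_norm_def less_imp_le)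
    finally show "star_err_fun \<Lambda> u \<le> ?R" .
  qed
  show "?R \<le> ?L"
  proof (intro SUP_least, clarify)
    fix b :: "multiindex \<Rightarrow> real" assume b: "\<forall>\<nu>. 0 \<le> b \<nu>" "lp_norm p b UNIV \<le> 1"
    \<comment> \<open>A unit direction turns the scalar weights into coefficients of prescribed
      norm.\<close>
    obtain z :: 'x where z: "norm z = 1" using nonzero norm_sgn by metis
    show "(\<Sum>\<^sub>\<infinity>\<nu>\<in>-\<Lambda>. ennreal (b \<nu> * inverse (mpow \<rho> \<nu>))) \<le> ?L"
      unfolding infsum_le_iff_ennreal
    proof (intro allI impI)
      fix F assume F: "finite F" "F \<subseteq> - \<Lambda>"
      define c where "c \<nu> = (b \<nu> * inverse (mpow \<rho> \<nu>)) *\<^sub>R z" for \<nu>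
      have norm_c: "norm (c \<nu>) = b \<nu> * inverse (mpow \<rho> \<nu>)" for \<nu>
        using b pos[of \<nu>] z by (simp add: c_def abs_mult)
      define u where "u = (\<lambda>y. \<Sum>\<nu>\<in>F. mpow y \<nu> *\<^sub>R c \<nu>)"
      have exp: "has_expansion (\<lambda>\<nu>. if \<nu> \<in> F then c \<nu> else 0) u"
        unfolding u_def by (rule has_expansion_poly[OF F(1)])
      note coeffs = coeffs_eq[OF exp]
      have "B_norm \<rho> p u \<le> lp_norm p b UNIV"
        unfolding B_norm_def coeffs
      proof (rule lp_norm_mono)
        fix \<nu>
        have "mpow \<rho> \<nu> * norm (c \<nu>) = b \<nu>"
          using pos[of \<nu>] by (simp add: norm_c field_simps)
        then show "\<bar>mpow \<rho> \<nu> * norm (if \<nu> \<in> F then c \<nu> else 0)\<bar> \<le> \<bar>b \<nu>\<bar>"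
          by auto
      qed
      then have norm: "B_norm \<rho> p u \<le> 1" using b(2) by (rule order_trans)
      have "u \<in> B_ball \<rho> p"
        unfolding B_ball_def B_space_def
        using norm has_expansion_representable[OF exp] poly_mem_linf_space
          le_less_trans[OF norm, of \<infinity>]
        by (simp add: u_def)
      then have "star_err_fun \<Lambda> u \<le> ?L"
        unfolding star_err_set_def by (rule SUP_upper)
      moreover have "(\<Sum>\<nu>\<in>F. ennreal (b \<nu> * inverse (mpow \<rho> \<nu>))) \<le> star_err_fun \<Lambda> u"
        using sum_le_infsum_ennreal[OF F, of "\<lambda>\<nu>. ennreal (norm (coeffs u \<nu>))"]
        by (simp add: star_err_fun_eq[OF has_expansion_representable[OF exp] \<Lambda>] coeffs norm_c
            cong: sum.cong)
      ultimately show "(\<Sum>\<nu>\<in>F. ennreal (b \<nu> * inverse (mpow \<rho> \<nu>))) \<le> ?L"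
        by (rule order_trans[rotated])
    qed
  qed
qed

text \<open>Mass that \<open>b\<close> has on \<open>\<Lambda> - \<Lambda>'\<close> is moved injectively to \<open>\<Lambda>' - \<Lambda>\<close>, where
  it contributes at least as much to the error.\<close>

lemma star_err_set_le:
  assumes nonzero: "\<exists>x::'x::real_normed_vector. x \<noteq> 0"
    and adm: "admissible \<rho>" and fin: "finite \<Lambda>" "finite \<Lambda>'" and card: "card \<Lambda> \<le> card \<Lambda>'"
    and sep: "\<And>\<mu> \<nu>. \<mu> \<in> \<Lambda>' \<Longrightarrow> \<nu> \<notin> \<Lambda>' \<Longrightarrow> inverse (mpow \<rho> \<nu>) \<le> inverse (mpow \<rho> \<mu>)"
  shows "star_err_set \<Lambda>' (B_ball \<rho> p :: ((nat \<Rightarrow> real) \<Rightarrow> 'x) set) \<le>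
    star_err_set \<Lambda> (B_ball \<rho> p :: ((nat \<Rightarrow> real) \<Rightarrow> 'x) set)"
proof -
  let ?a = "\<lambda>\<nu>. inverse (mpow \<rho> \<nu>)"
  \<comment> \<open>Removing the common part \<open>\<Lambda> \<inter> \<Lambda>'\<close> from both
    sets preserves the comparison of cardinalities.\<close>
  have "card (\<Lambda> - \<Lambda>') \<le> card (\<Lambda>' - \<Lambda>)"
    using card fin by (simp add: card_Diff_subset_Int Int_commute)
  then obtain \<phi> where \<phi>: "\<phi> ` (\<Lambda> - \<Lambda>') \<subseteq> \<Lambda>' - \<Lambda>" "inj_on \<phi> (\<Lambda> - \<Lambda>')"
    using card_le_inj[of "\<Lambda> - \<Lambda>'" "\<Lambda>' - \<Lambda>"] fin by auto
  define g where "g \<nu> = (if \<nu> \<in> \<Lambda> then \<phi> \<nu> else \<nu>)" for \<nu>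
  \<comment> \<open>No collisions: the values of \<open>\<phi>\<close> lie in
    \<open>\<Lambda>'\<close>, whereas the indices that \<open>g\<close> leaves in place lie outside
    it.\<close>
  have inj: "inj_on g (- \<Lambda>')"
    using \<phi> unfolding inj_on_def g_def by (auto split: if_splits)
  have g: "g ` (- \<Lambda>') \<subseteq> - \<Lambda>"
    using \<phi>(1) by (auto simp: g_def)
  have ag: "?a \<nu> \<le> ?a (g \<nu>)" if "\<nu> \<notin> \<Lambda>'" for \<nu>
    using \<phi>(1) that sep[of "\<phi> \<nu>" \<nu>] by (auto simp: g_def)
  show ?thesis
    unfolding star_err_set_B_ball[OF nonzero adm fin(1)] star_err_set_B_ball[OF nonzero adm fin(2)]
  proof (rule SUP_mono, clarify)
    fix b :: "multiindex \<Rightarrow> real" assume b: "\<forall>\<nu>. 0 \<le> b \<nu>" "lp_norm p b UNIV \<le> 1"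
    \<comment> \<open>The restriction of \<open>b\<close> to the complement of
      \<open>\<Lambda>'\<close>, transported along \<open>g\<close> and extended by 0; its norm is
      at most that of \<open>b\<close>.\<close>
    define b' where
      "b' \<mu> = (if \<mu> \<in> g ` (- \<Lambda>') then b (inv_into (- \<Lambda>') g \<mu>) else 0)" for \<mu>
    have b'g: "b' (g \<nu>) = b \<nu>" if "\<nu> \<in> - \<Lambda>'" for \<nu>
      using inj that by (simp add: b'_def)
    have "lp_norm p b' UNIV = lp_norm p b' (g ` (- \<Lambda>'))"
      by (rule lp_norm_neutral[symmetric]) (auto simp: b'_def)
    also have "\<dots> = lp_norm p (\<lambda>\<nu>. b' (g \<nu>)) (- \<Lambda>')"
      by (rule lp_norm_reindex[OF inj])
    also have "\<dots> \<le> lp_norm p b (- \<Lambda>')"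
      by (rule lp_norm_mono) (simp add: b'g)
    also have "\<dots> \<le> lp_norm p b UNIV" by (rule lp_norm_mono_set) simp
    finally have "lp_norm p b' UNIV \<le> 1" using b(2) by (rule order_trans)
    moreover have "\<forall>\<nu>. 0 \<le> b' \<nu>" using b by (simp add: b'_def)
    moreover have "(\<Sum>\<^sub>\<infinity>\<nu>\<in>-\<Lambda>'. ennreal (b \<nu> * ?a \<nu>)) \<le> (\<Sum>\<^sub>\<infinity>\<nu>\<in>-\<Lambda>. ennreal (b' \<nu> * ?a \<nu>))"
    proof -
      have "(\<Sum>\<^sub>\<infinity>\<nu>\<in>-\<Lambda>'. ennreal (b \<nu> * ?a \<nu>)) \<le> (\<Sum>\<^sub>\<infinity>\<nu>\<in>-\<Lambda>'. ennreal (b' (g \<nu>) * ?a (g \<nu>)))"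
        using b ag by (intro infsum_mono_ennreal) (auto simp: b'g intro!: ennreal_leI mult_left_mono)
      also have "\<dots> = (\<Sum>\<^sub>\<infinity>\<nu>\<in>g ` (-\<Lambda>'). ennreal (b' \<nu> * ?a \<nu>))"
        by (simp add: infsum_reindex[OF inj] o_def)
      also have "\<dots> \<le> (\<Sum>\<^sub>\<infinity>\<nu>\<in>-\<Lambda>. ennreal (b' \<nu> * ?a \<nu>))"
        by (rule infsum_mono_set_ennreal[OF g])
      finally show ?thesis .
    qed
    ultimately show "\<exists>b'\<in>{b. (\<forall>\<nu>. 0 \<le> b \<nu>) \<and> lp_norm p b UNIV \<le> 1}.
        (\<Sum>\<^sub>\<infinity>\<nu>\<in>-\<Lambda>'. ennreal (b \<nu> * ?a \<nu>)) \<le> (\<Sum>\<^sub>\<infinity>\<nu>\<in>-\<Lambda>. ennreal (b' \<nu> * ?a \<nu>))"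
      by blast
  qed
qed

section \<open>The decreasing rearrangement and its tails\<close>

text \<open>Exposes the bijection behind \<open>delta\<close>. The shift by \<open>Suc\<close>
  arises because \<open>e\<close> starts at 0 and \<open>delta\<close> at 1.\<close>

lemma obtain_delta_enumeration:
  assumes "admissible \<rho>"
  obtains e where "bij e" "\<And>k. delta \<rho> (Suc k) = inverse (mpow \<rho> (e k))"
    "\<And>j k. j \<le> k \<Longrightarrow> inverse (mpow \<rho> (e k)) \<le> inverse (mpow \<rho> (e j))"
proof -
  let ?D = "decreasing_rearrangement (\<lambda>\<nu>. inverse (mpow \<rho> \<nu>))"
  have "?D (THE d. ?D d)" by (rule theI'[OF ex1_delta_sequence[OF assms]])
  then obtain e where e: "bij e" "(THE d. ?D d) = (\<lambda>\<nu>. inverse (mpow \<rho> \<nu>)) \<circ> e"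
      "decseq (THE d. ?D d)"
    unfolding decreasing_rearrangement_def by blast
  show ?thesis
  proof (rule that[OF e(1)])
    show "delta \<rho> (Suc k) = inverse (mpow \<rho> (e k))" for k by (simp add: delta_def e(2))
    show "inverse (mpow \<rho> (e k)) \<le> inverse (mpow \<rho> (e j))" if "j \<le> k" for j k
      using decseqD[OF e(3) that] by (simp add: e(2))
  qed
qed

text \<open>Only \<open>q = \<infinity>\<close> needs an argument: the rearrangement is nonnegative
  and nonincreasing, so the supremum of a tail is its first entry.\<close>

lemma delta_tail_eq_lp_norm:
  assumes adm: "admissible \<rho>"
  shows "delta_tail n q \<rho> = lp_norm q (delta \<rho>) {n<..}"
proof (cases "q = \<infinity>")
  case True
  obtain e where "bij e" and e: "\<And>k. delta \<rho> (Suc k) = inverse (mpow \<rho> (e k))"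
    "\<And>j k. j \<le> k \<Longrightarrow> inverse (mpow \<rho> (e k)) \<le> inverse (mpow \<rho> (e j))"
    using obtain_delta_enumeration[OF adm] by blast
  have nonneg: "0 \<le> delta \<rho> (Suc j)" for j
    unfolding e(1) using mpow_pos[OF adm, of "e j"] by simp
  have "(SUP k\<in>{n<..}. ennreal \<bar>delta \<rho> k\<bar>) = ennreal (delta \<rho> (Suc n))"
  proof (rule antisym)
    show "(SUP k\<in>{n<..}. ennreal \<bar>delta \<rho> k\<bar>) \<le> ennreal (delta \<rho> (Suc n))"
    proof (rule SUP_least)
      fix k assume "k \<in> {n<..}"
      then obtain j where j: "k = Suc j" "n \<le> j" by (auto dest: less_imp_Suc_add)
      have "delta \<rho> (Suc j) \<le> delta \<rho> (Suc n)" unfolding e(1) by (rule e(2)[OF j(2)])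
      then show "ennreal \<bar>delta \<rho> k\<bar> \<le> ennreal (delta \<rho> (Suc n))"
        unfolding j(1) abs_of_nonneg[OF nonneg] by (rule ennreal_leI)
    qed
    have "ennreal (delta \<rho> (Suc n)) = ennreal \<bar>delta \<rho> (Suc n)\<bar>"
      by (simp only: abs_of_nonneg[OF nonneg])
    also have "\<dots> \<le> (SUP k\<in>{n<..}. ennreal \<bar>delta \<rho> k\<bar>)" by (rule SUP_upper) simp
    finally show "ennreal (delta \<rho> (Suc n)) \<le> (SUP k\<in>{n<..}. ennreal \<bar>delta \<rho> k\<bar>)" .
  qed
  then show ?thesis unfolding True lp_norm_infinity delta_tail_def by simp
qed (simp add: delta_tail_def)

theorem theorem3p1:
  fixes \<rho> :: "nat \<Rightarrow> real" and p :: ennreal and n :: nat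
    and \<Lambda>n :: "multiindex set"
    and U :: "((nat \<Rightarrow> real) \<Rightarrow> 'x::banach) set"
  assumes nonzero: "\<exists>x::'x. x \<noteq> 0"
    and adm: "admissible \<rho>"
    and p: "0 < p"
    and n: "n \<ge> 1"
    and Lambda: "is_Lambda n \<rho> \<Lambda>n"
    and U: "U = B_ball \<rho> p"
  shows
    "(\<Lambda>n \<in> lower_sets n \<and>
      (\<forall>\<Lambda>\<in>lower_sets n. star_err_set \<Lambda>n U \<le> star_err_set \<Lambda> U) \<and>
      err_n n U \<le> err_set \<Lambda>n U \<and>
      err_set \<Lambda>n U \<le> star_err_set \<Lambda>n U) \<and>
     (\<forall>q::ennreal. 1 \<le> p \<longrightarrow> 1 / p + 1 / q = 1 \<longrightarrow>
      err_n n U \<le> err_set \<Lambda>n U \<and>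
      err_set \<Lambda>n U \<le> star_err_set \<Lambda>n U \<and>
      star_err_set \<Lambda>n U = delta_tail n q \<rho>)"
proof -
  let ?a = "\<lambda>\<nu>. inverse (mpow \<rho> \<nu>)"
  have fin: "finite \<Lambda>n" and card: "card \<Lambda>n = n" and lower: "\<Lambda>n \<in> lower_sets n"
    using Lambda by (auto simp: is_Lambda_def lower_sets_def)
  \<comment> \<open>The threshold \<open>delta \<rho> n\<close> separates the two values: indices
    strictly above it all belong to \<open>\<Lambda>n\<close>, and no index of
    \<open>\<Lambda>n\<close> is below it.\<close>
  have sep: "?a \<nu> \<le> ?a \<mu>" if "\<mu> \<in> \<Lambda>n" "\<nu> \<notin> \<Lambda>n" for \<mu> \<nu>
  proof -
    have "?a \<nu> \<le> delta \<rho> n" using Lambda that(2) unfolding is_Lambda_def by force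
    also have "\<dots> \<le> ?a \<mu>" using Lambda that(1) unfolding is_Lambda_def superlevel_def by blast
    finally show ?thesis .
  qed
  \<comment> \<open>Stated for finite sets so that it also applies to the initial segment
    \<open>?L\<close> of the enumeration below.\<close>
  have minimal: "star_err_set \<Lambda>n U \<le> star_err_set \<Lambda> U" if "finite \<Lambda>" "card \<Lambda> \<le> n" for \<Lambda>
    unfolding U using nonzero adm that fin card sep by (intro star_err_set_le) auto
  have part1: "err_n n U \<le> err_set \<Lambda>n U" "err_set \<Lambda>n U \<le> star_err_set \<Lambda>n U"
    using lower err_set_le_star_err_set[OF fin B_ball_representable] by (auto simp: err_n_def U intro: INF_lower)
  have dual: "star_err_set \<Lambda>n U = delta_tail n q \<rho>" if pq: "1 \<le> p" "1 / p + 1 / q = 1" for q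
  proof -
    obtain e where e: "bij e" "\<And>k. delta \<rho> (Suc k) = ?a (e k)"
      "\<And>j k. j \<le> k \<Longrightarrow> ?a (e k) \<le> ?a (e j)"
      using obtain_delta_enumeration[OF adm] by blast
    have inj: "inj_on e A" for A using e(1) by (auto simp: bij_def intro: inj_on_subset)
    \<comment> \<open>Ties at the threshold may make \<open>\<Lambda>n\<close> differ from this
      segment, but the exchange argument works in both directions, so the surrogate errors agree.
      The complement of the segment is the tail of the enumeration.\<close>
    let ?L = "e ` {..<n}"
    have compl: "- ?L = e ` {n..}"
      using bij_image_Compl_eq[OF e(1), of "{..<n}"] by (simp add: Compl_lessThan)
    have cardL: "card ?L = n" by (simp add: card_image[OF inj])
    have "star_err_set ?L U \<le> star_err_set \<Lambda>n U"
      unfolding U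
    proof (rule star_err_set_le[OF nonzero adm fin])
      fix \<mu> \<nu> assume "\<mu> \<in> ?L" "\<nu> \<notin> ?L"
      then obtain j k where "\<mu> = e j" "j < n" "\<nu> = e k" "n \<le> k"
        using compl by (metis ComplI atLeast_iff imageE lessThan_iff)
      then show "?a \<nu> \<le> ?a \<mu>" by (simp only: e(3))
    qed (simp_all add: card cardL)
    then have "star_err_set \<Lambda>n U = star_err_set ?L U"
      using minimal[of ?L] cardL by (intro antisym) auto
    also have "\<dots> = lp_norm q ?a (- ?L)"
    proof -
      have "0 \<le> ?a \<nu>" for \<nu> using mpow_pos[OF adm, of \<nu>] by simp
      then show ?thesis
        using lp_norm_dual[OF pq, of ?a "- ?L"]
        unfolding U by (subst star_err_set_B_ball[OF nonzero adm]) auto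
    qed
    \<comment> \<open>Position \<open>k\<close> of the enumeration is entry \<open>k + 1\<close> of
      \<open>delta\<close>, so positions from \<open>n\<close> on become indices greater than
      \<open>n\<close>.\<close>
    also have "\<dots> = lp_norm q (\<lambda>k. delta \<rho> (Suc k)) {n..}"
      unfolding compl by (simp add: lp_norm_reindex[OF inj] e(2))
    also have "\<dots> = lp_norm q (delta \<rho>) (Suc ` {n..})"
      by (simp add: lp_norm_reindex)
    also have "Suc ` {n..} = {n<..}"
    proof (intro equalityI subsetI)
      fix k assume "k \<in> {n<..}"
      then have "k = Suc (k - 1)" "k - 1 \<in> {n..}" by auto
      then show "k \<in> Suc ` {n..}" by (rule image_eqI)
    qed auto
    finally show ?thesis using delta_tail_eq_lp_norm[OF adm] by simp
  qed
  show ?thesis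
    using lower minimal part1 dual by (auto simp: lower_sets_def)
qed

end
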